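(* Let $A$ be a locally compact abelian group and $M$ an LC $A$-module. Then $\{0\}\subseteq \mathrm{W}^\flat(M)\subseteq \Omega^\sharp(M)\subseteq M$. If moreover $A$ is compactly generated, then $\mathrm{W}^\flat(M)$ is a compact parafinite submodule, $\Omega^\sharp(M)$ is open and $M/\Omega^\sharp(M)$ is purely discrete, and the subquotient $\Omega^\sharp(M)/\mathrm{W}^\flat(M)$ is sheer.
   Context: All topological groups are Hausdorff. An LC $A$-module is an LCA group $M$ with a continuous action of the LCA group $A$ by topological automorphisms. An LC $A$-module is compact parafinite if it is compact and has no nonzero finite quotient module; it is purely discrete if it is discrete and has no nonzero finite submodule. $\mathrm{W}^\flat(M)$ (reduced polycompact radical) is the sum of all compact parafinite submodules of $M$. $\Omega^\sharp(M)$ (augmented codiscrete radical) is the intersection of all open submodules $U\subseteq M$ such that $M/U$ is purely discrete. $M$ is sheer if $\mathrm{W}^\flat(M)=\{0\}$ and $\Omega^\sharp(M)=M$. *)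

theory Defs
  imports "HOL-Analysis.Analysis"
begin

record ('a, 'b) lcmod =
  carrier :: "'a set"
  add :: "'a \<Rightarrow> 'a \<Rightarrow> 'a"
  zero :: 'a
  neg :: "'a \<Rightarrow> 'a"
  top :: "'a topology"
  act :: "'b \<Rightarrow> 'a \<Rightarrow> 'a"

text \<open>The acting group A: an LCA group, realised as a type of class
  topological_ab_group_add (continuous addition and negation), which is Hausdorff and
  locally compact.\<close>

definition LCA_type :: "'b::{topological_ab_group_add, t2_space} itself \<Rightarrow> bool" where
  "LCA_type _ \<longleftrightarrow> locally_compact_space (euclidean :: 'b topology)"

definition gen_subgroup :: "'b::ab_group_add set \<Rightarrow> 'b set" where
  "gen_subgroup K = \<Inter>{H. K \<subseteq> H \<and> 0 \<in> H \<and> (\<forall>x\<in>H. \<forall>y\<in>H. x + y \<in> H) \<and> (\<forall>x\<in>H. - x \<in> H)}"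

definition compactly_generated :: "'b::{topological_ab_group_add} itself \<Rightarrow> bool" where
  "compactly_generated _ \<longleftrightarrow> (\<exists>K::'b set. compact K \<and> gen_subgroup K = UNIV)"

definition topological_abgroup :: "('a, 'b) lcmod \<Rightarrow> bool" where
  "topological_abgroup M \<longleftrightarrow>
     zero M \<in> carrier M \<and>
     (\<forall>x\<in>carrier M. \<forall>y\<in>carrier M. add M x y \<in> carrier M) \<and>
     (\<forall>x\<in>carrier M. neg M x \<in> carrier M) \<and>
     (\<forall>x\<in>carrier M. \<forall>y\<in>carrier M. \<forall>z\<in>carrier M. add M (add M x y) z = add M x (add M y z)) \<and>
     (\<forall>x\<in>carrier M. \<forall>y\<in>carrier M. add M x y = add M y x) \<and>
     (\<forall>x\<in>carrier M. add M (zero M) x = x) \<and>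
     (\<forall>x\<in>carrier M. add M (neg M x) x = zero M) \<and>
     topspace (top M) = carrier M \<and>
     continuous_map (prod_topology (top M) (top M)) (top M) (\<lambda>(x, y). add M x y) \<and>
     continuous_map (top M) (top M) (neg M) \<and>
     Hausdorff_space (top M)"

definition LC_module :: "('a, 'b::{topological_ab_group_add, t2_space}) lcmod \<Rightarrow> bool" where
  "LC_module M \<longleftrightarrow>
     topological_abgroup M \<and>
     locally_compact_space (top M) \<and>
     (\<forall>a. \<forall>x\<in>carrier M. act M a x \<in> carrier M) \<and>
     (\<forall>a. \<forall>x\<in>carrier M. \<forall>y\<in>carrier M. act M a (add M x y) = add M (act M a x) (act M a y)) \<and>
     (\<forall>x\<in>carrier M. act M 0 x = x) \<and>
     (\<forall>a b. \<forall>x\<in>carrier M. act M (a + b) x = act M a (act M b x)) \<and>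
     continuous_map (prod_topology euclidean (top M)) (top M) (\<lambda>(a, x). act M a x)"

definition submodule :: "('a, 'b) lcmod \<Rightarrow> 'a set \<Rightarrow> bool" where
  "submodule M N \<longleftrightarrow> N \<subseteq> carrier M \<and> zero M \<in> N \<and>
     (\<forall>x\<in>N. \<forall>y\<in>N. add M x y \<in> N) \<and> (\<forall>x\<in>N. neg M x \<in> N) \<and>
     (\<forall>a. \<forall>x\<in>N. act M a x \<in> N)"

definition submod :: "('a, 'b) lcmod \<Rightarrow> 'a set \<Rightarrow> ('a, 'b) lcmod" where
  "submod M N = M\<lparr>carrier := N, top := subtopology (top M) N\<rparr>"

definition coset :: "('a, 'b) lcmod \<Rightarrow> 'a set \<Rightarrow> 'a \<Rightarrow> 'a set" where
  "coset M N x = (\<lambda>n. add M x n) ` N"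

definition quot :: "('a, 'b) lcmod \<Rightarrow> 'a set \<Rightarrow> ('a set, 'b) lcmod" where
  "quot M N = \<lparr>carrier = coset M N ` carrier M,
               add = (\<lambda>C D. {add M x y | x y. x \<in> C \<and> y \<in> D}),
               zero = N,
               neg = (\<lambda>C. neg M ` C),
               top = topology (\<lambda>S. S \<subseteq> coset M N ` carrier M \<and> openin (top M) (\<Union>S)),
               act = (\<lambda>a C. act M a ` C)\<rparr>"

text \<open>Compact parafinite: compact, and no nonzero finite quotient module
  (a quotient module M/U, U a closed submodule so that M/U is Hausdorff).\<close>
definition compact_parafinite :: "('a, 'b) lcmod \<Rightarrow> bool" where
  "compact_parafinite M \<longleftrightarrow> compact_space (top M) \<and>
     (\<forall>U. submodule M U \<and> closedin (top M) U \<and> finite (carrier (quot M U)) \<longrightarrow> U = carrier M)"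

definition purely_discrete :: "('a, 'b) lcmod \<Rightarrow> bool" where
  "purely_discrete M \<longleftrightarrow> top M = discrete_topology (carrier M) \<and>
     (\<forall>N. submodule M N \<and> finite N \<longrightarrow> N = {zero M})"

text \<open>Reduced polycompact radical: the sum (= the submodule generated by the union)
  of all compact parafinite submodules.\<close>
definition W_flat :: "('a, 'b) lcmod \<Rightarrow> 'a set" where
  "W_flat M = \<Inter>{S. submodule M S \<and>
      (\<forall>N. submodule M N \<and> compact_parafinite (submod M N) \<longrightarrow> N \<subseteq> S)}"

definition Omega_sharp :: "('a, 'b) lcmod \<Rightarrow> 'a set" where
  "Omega_sharp M = \<Inter>{U. submodule M U \<and> openin (top M) U \<and> purely_discrete (quot M U)}"

definition sheer :: "('a, 'b) lcmod \<Rightarrow> bool" where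
  "sheer M \<longleftrightarrow> W_flat M = {zero M} \<and> Omega_sharp M = carrier M"

end

theory Submission
  imports Defs
begin

text \<open>
  Both halves rest on the same trick. Let \<open>V\<close> be a compact neighbourhood of zero and \<open>P\<close> an open
  neighbourhood so small that \<open>P + P\<close>, \<open>- P\<close> and \<open>K P\<close> lie in \<open>V\<close>, where \<open>K\<close> is a compact symmetric
  generating set of \<open>A\<close>. If submodules \<open>N \<subseteq> L\<close> satisfy \<open>V \<inter> L \<subseteq> N + P\<close>, then \<open>N + (V \<inter> L)\<close> is again
  a submodule.

  For \<open>N = \<Omega>\<close>, compactness of \<open>V\<close> gives a single open submodule \<open>L\<close> with purely discrete quotient
  satisfying this, and the submodule \<open>\<Omega> + (V \<inter> L)\<close> has finite image in every purely discrete \<open>M/U\<close>;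
  hence \<open>V \<inter> L \<subseteq> \<Omega>\<close> and \<open>\<Omega>\<close> is open. For \<open>L\<close> the closure of the sum of all compact parafinite
  submodules, compactness of \<open>V \<inter> L\<close> gives a single compact parafinite \<open>N\<close> satisfying it, so
  \<open>N + (V \<inter> L)\<close> is a compact open submodule of \<open>L\<close>; it absorbs every compact parafinite
  submodule, so \<open>L\<close> is compact, and then itself parafinite.
\<close>

section \<open>Submodules and quotients\<close>

text \<open>On \<open>A\<close> the map \<open>g\<close> factors through \<open>f\<close>, so its
  image is the image under some function of a finite set.\<close>

lemma finite_image_factor:
  assumes "finite (f ` A)" and "\<And>x y. x \<in> A \<Longrightarrow> y \<in> A \<Longrightarrow> f x = f y \<Longrightarrow> g x = g y"
  shows "finite (g ` A)"
proof -
  have "g ` A \<subseteq> (\<lambda>c. g (SOME x. x \<in> A \<and> f x = c)) ` f ` A"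
  proof
    fix z assume "z \<in> g ` A"
    then obtain x where x: "x \<in> A" "z = g x" by blast
    have "(SOME y. y \<in> A \<and> f y = f x) \<in> A \<and> f (SOME y. y \<in> A \<and> f y = f x) = f x"
      by (rule someI[of _ x]) (use x in simp)
    then have "g x = g (SOME y. y \<in> A \<and> f y = f x)"
      using assms(2) x by metis
    then show "z \<in> (\<lambda>c. g (SOME x. x \<in> A \<and> f x = c)) ` f ` A"
      using x by blast
  qed
  then show ?thesis
    using assms(1) finite_subset by blast
qed

lemma submod_simps [simp]:
  "carrier (submod M N) = N" "top (submod M N) = subtopology (top M) N"
  "add (submod M N) = add M" "neg (submod M N) = neg M" "zero (submod M N) = zero M"
  "act (submod M N) = act M" "coset (submod M N) = coset M"
  by (auto simp: submod_def coset_def fun_eq_iff)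

lemma submod_submod: "N \<subseteq> S \<Longrightarrow> submod (submod M S) N = submod M N"
  by (simp add: submod_def subtopology_subtopology Int_absorb1)

text \<open>The topology enters only through its underlying set. Hence the quotient by an arbitrary
  submodule, closed or not, is again an instance and inherits all algebraic lemmas.\<close>

locale abgroup_action =
  fixes M :: "('a, 'b::ab_group_add) lcmod"
  assumes zero_in [simp]: "zero M \<in> carrier M"
    and add_in [simp]: "x \<in> carrier M \<Longrightarrow> y \<in> carrier M \<Longrightarrow> add M x y \<in> carrier M"
    and neg_in [simp]: "x \<in> carrier M \<Longrightarrow> neg M x \<in> carrier M"
    and add_assoc: "x \<in> carrier M \<Longrightarrow> y \<in> carrier M \<Longrightarrow> z \<in> carrier M \<Longrightarrow>
          add M (add M x y) z = add M x (add M y z)"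
    and add_comm: "x \<in> carrier M \<Longrightarrow> y \<in> carrier M \<Longrightarrow> add M x y = add M y x"
    and zero_add [simp]: "x \<in> carrier M \<Longrightarrow> add M (zero M) x = x"
    and neg_add [simp]: "x \<in> carrier M \<Longrightarrow> add M (neg M x) x = zero M"
    and topspace_eq: "topspace (top M) = carrier M"
    and act_in [simp]: "x \<in> carrier M \<Longrightarrow> act M a x \<in> carrier M"
    and act_add: "x \<in> carrier M \<Longrightarrow> y \<in> carrier M \<Longrightarrow>
          act M a (add M x y) = add M (act M a x) (act M a y)"
    and act_0 [simp]: "x \<in> carrier M \<Longrightarrow> act M 0 x = x"
    and act_act: "x \<in> carrier M \<Longrightarrow> act M (a + b) x = act M a (act M b x)"
begin

abbreviation plus_M (infixl "\<oplus>" 65) where "x \<oplus> y \<equiv> add M x y"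
abbreviation neg_M ("\<ominus> _" [81] 80) where "\<ominus> x \<equiv> neg M x"
abbreviation "C \<equiv> carrier M"

section \<open>Arithmetic of the group and of the action\<close>

lemma add_zero [simp]: "x \<in> C \<Longrightarrow> x \<oplus> zero M = x"
  using add_comm zero_add zero_in by metis

lemma add_neg [simp]: "x \<in> C \<Longrightarrow> x \<oplus> \<ominus> x = zero M"
  using add_comm neg_add neg_in by metis

lemma add_lcomm: "x \<in> C \<Longrightarrow> y \<in> C \<Longrightarrow> z \<in> C \<Longrightarrow> x \<oplus> (y \<oplus> z) = y \<oplus> (x \<oplus> z)"
  using add_assoc add_comm by metis

lemmas add_ac = add_assoc add_comm add_lcomm

lemma neg_add_cancel [simp]: "x \<in> C \<Longrightarrow> y \<in> C \<Longrightarrow> \<ominus> x \<oplus> (x \<oplus> y) = y"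
  by (metis add_assoc neg_add neg_in zero_add)

lemma add_neg_cancel [simp]: "x \<in> C \<Longrightarrow> y \<in> C \<Longrightarrow> x \<oplus> (\<ominus> x \<oplus> y) = y"
  by (metis add_assoc add_neg neg_in zero_add)

lemma add_diff [simp]: "x \<in> C \<Longrightarrow> y \<in> C \<Longrightarrow> x \<oplus> (y \<oplus> \<ominus> x) = y"
  by (metis add_comm add_neg_cancel neg_in)

lemma add_left_cancel: "x \<in> C \<Longrightarrow> y \<in> C \<Longrightarrow> z \<in> C \<Longrightarrow> x \<oplus> y = x \<oplus> z \<longleftrightarrow> y = z"
  by (metis neg_add_cancel)

lemma neg_unique: "x \<in> C \<Longrightarrow> y \<in> C \<Longrightarrow> x \<oplus> y = zero M \<Longrightarrow> y = \<ominus> x"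
  by (metis add_neg add_left_cancel neg_in)

lemma neg_neg [simp]: "x \<in> C \<Longrightarrow> \<ominus> (\<ominus> x) = x"
  by (metis neg_unique neg_add neg_in)

lemma neg_zero [simp]: "\<ominus> (zero M) = zero M"
  by (metis neg_unique zero_add zero_in)

lemma neg_sum: "x \<in> C \<Longrightarrow> y \<in> C \<Longrightarrow> \<ominus> (x \<oplus> y) = \<ominus> x \<oplus> \<ominus> y"
  by (rule neg_unique[symmetric]) (simp_all add: add_ac)

lemma act_zero [simp]: "act M a (zero M) = zero M"
  by (metis act_add act_in add_left_cancel add_zero zero_in)

lemma act_neg: "x \<in> C \<Longrightarrow> act M a (\<ominus> x) = \<ominus> (act M a x)"
  by (rule neg_unique) (simp_all add: act_add[symmetric])

lemma act_uminus [simp]: "x \<in> C \<Longrightarrow> act M a (act M (- a) x) = x"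
  by (simp add: act_act[symmetric])

section \<open>Submodules, intersections and sums\<close>

lemma submodule_carrier [simp]: "submodule M C"
  by (simp add: submodule_def)

lemma submodule_zero [simp]: "submodule M {zero M}"
  by (simp add: submodule_def)

lemma submoduleD:
  assumes "submodule M U"
  shows "U \<subseteq> C" "zero M \<in> U" "x \<in> U \<Longrightarrow> x \<in> C" "x \<in> U \<Longrightarrow> y \<in> U \<Longrightarrow> x \<oplus> y \<in> U"
    "x \<in> U \<Longrightarrow> \<ominus> x \<in> U" "x \<in> U \<Longrightarrow> act M a x \<in> U"
  using assms by (auto simp: submodule_def)

lemma submodule_Inter:
  assumes "\<F> \<noteq> {}" "\<And>U. U \<in> \<F> \<Longrightarrow> submodule M U"
  shows "submodule M (\<Inter>\<F>)"
  using assms unfolding submodule_def by blast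

lemma submodule_Int: "submodule M U \<Longrightarrow> submodule M T \<Longrightarrow> submodule M (U \<inter> T)"
  unfolding submodule_def by blast

text \<open>Formed for arbitrary sets, since the second summand will often be only a neighbourhood
  of zero.\<close>

definition setsum :: "'a set \<Rightarrow> 'a set \<Rightarrow> 'a set" where
  "setsum S T = {x \<oplus> y |x y. x \<in> S \<and> y \<in> T}"

lemma setsumI: "x \<in> S \<Longrightarrow> y \<in> T \<Longrightarrow> x \<oplus> y \<in> setsum S T"
  unfolding setsum_def by blast

lemma setsumE:
  assumes "z \<in> setsum S T"
  obtains x y where "z = x \<oplus> y" "x \<in> S" "y \<in> T"
  using assms unfolding setsum_def by blast

lemma setsum_upper:
  assumes "submodule M U" "submodule M T"
  shows "U \<subseteq> setsum U T" "T \<subseteq> setsum U T"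
proof -
  show "U \<subseteq> setsum U T"
  proof
    fix x assume "x \<in> U"
    then show "x \<in> setsum U T"
      using setsumI[of x U "zero M" T] submoduleD(3)[OF assms(1)] submoduleD(2)[OF assms(2)] by simp
  qed
  show "T \<subseteq> setsum U T"
  proof
    fix x assume "x \<in> T"
    then show "x \<in> setsum U T"
      using setsumI[of "zero M" U x T] submoduleD(3)[OF assms(2)] submoduleD(2)[OF assms(1)] by simp
  qed
qed

lemma setsum_subset: "S \<subseteq> C \<Longrightarrow> T \<subseteq> C \<Longrightarrow> setsum S T \<subseteq> C"
  unfolding setsum_def using add_in by blast

lemma submodule_setsum:
  assumes U: "submodule M U" and T: "submodule M T"
  shows "submodule M (setsum U T)"
  unfolding submodule_def
proof (intro conjI ballI allI)
  show "setsum U T \<subseteq> C" using setsum_subset U T submoduleD(1) by blast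
  show "zero M \<in> setsum U T" using setsum_upper(1)[OF U T] submoduleD(2)[OF U] by blast
  fix z assume "z \<in> setsum U T"
  then obtain x y where z: "z = x \<oplus> y" "x \<in> U" "y \<in> T" by (rule setsumE)
  then have xy: "x \<in> C" "y \<in> C" using submoduleD(3) U T by blast+
  have "\<ominus> z = \<ominus> x \<oplus> \<ominus> y" using z xy by (simp add: neg_sum)
  then show "\<ominus> z \<in> setsum U T"
    using z(2,3) submoduleD(5) U T by (simp add: setsumI)
  show "act M a z \<in> setsum U T" for a
    using z submoduleD(6) U T xy by (simp add: act_add setsumI)
  fix z' assume "z' \<in> setsum U T"
  then obtain x' y' where z': "z' = x' \<oplus> y'" "x' \<in> U" "y' \<in> T" by (rule setsumE)
  then have xy': "x' \<in> C" "y' \<in> C" using submoduleD(3) U T by blast+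
  have "z \<oplus> z' = (x \<oplus> x') \<oplus> (y \<oplus> y')"
    using z z' xy xy' by (simp add: add_ac)
  then show "z \<oplus> z' \<in> setsum U T"
    using z(2,3) z'(2,3) submoduleD(4) U T by (simp add: setsumI)
qed

section \<open>Cosets of a submodule\<close>

lemma mem_coset:
  assumes "submodule M U" "x \<in> C"
  shows "y \<in> coset M U x \<longleftrightarrow> y \<in> C \<and> y \<oplus> \<ominus> x \<in> U"
proof
  assume "y \<in> coset M U x"
  then obtain u where "u \<in> U" "y = x \<oplus> u" by (auto simp: coset_def)
  moreover from this have "u \<in> C" by (intro submoduleD(3)[OF assms(1)])
  ultimately show "y \<in> C \<and> y \<oplus> \<ominus> x \<in> U" using assms(2) by (simp add: add_ac)
next
  assume y: "y \<in> C \<and> y \<oplus> \<ominus> x \<in> U"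
  then have "y = x \<oplus> (y \<oplus> \<ominus> x)" using assms by simp
  then show "y \<in> coset M U x" using y unfolding coset_def by blast
qed

lemma coset_subset: "submodule M U \<Longrightarrow> x \<in> C \<Longrightarrow> coset M U x \<subseteq> C"
  using mem_coset by blast

lemma self_in_coset: "submodule M U \<Longrightarrow> x \<in> C \<Longrightarrow> x \<in> coset M U x"
  by (simp add: mem_coset submoduleD(2))

lemma coset_eq_iff:
  assumes "submodule M U" "x \<in> C" "y \<in> C"
  shows "coset M U x = coset M U y \<longleftrightarrow> x \<oplus> \<ominus> y \<in> U"
proof
  assume "coset M U x = coset M U y"
  then show "x \<oplus> \<ominus> y \<in> U" using self_in_coset mem_coset assms by metis
next
  assume xy: "x \<oplus> \<ominus> y \<in> U"
  then have "\<ominus> (x \<oplus> \<ominus> y) \<in> U" by (rule submoduleD(5)[OF assms(1)])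
  then have yx: "y \<oplus> \<ominus> x \<in> U" using assms by (simp add: neg_sum add_comm)
  have *: "z \<in> C \<Longrightarrow> z \<oplus> \<ominus> y = (z \<oplus> \<ominus> x) \<oplus> (x \<oplus> \<ominus> y)" for z
    using assms by (simp add: add_assoc)
  have **: "z \<in> C \<Longrightarrow> z \<oplus> \<ominus> x = (z \<oplus> \<ominus> y) \<oplus> (y \<oplus> \<ominus> x)" for z
    using assms by (simp add: add_assoc)
  show "coset M U x = coset M U y"
  proof (intro set_eqI)
    fix z
    have "z \<oplus> \<ominus> x \<in> U \<longleftrightarrow> z \<oplus> \<ominus> y \<in> U" if "z \<in> C"
    proof
      assume "z \<oplus> \<ominus> x \<in> U"
      then show "z \<oplus> \<ominus> y \<in> U"
        unfolding *[OF that] by (rule submoduleD(4)[OF assms(1) _ xy])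
    next
      assume "z \<oplus> \<ominus> y \<in> U"
      then show "z \<oplus> \<ominus> x \<in> U"
        unfolding **[OF that] by (rule submoduleD(4)[OF assms(1) _ yx])
    qed
    then show "z \<in> coset M U x \<longleftrightarrow> z \<in> coset M U y"
      using mem_coset[OF assms(1,2)] mem_coset[OF assms(1,3)] by blast
  qed
qed

lemma coset_eq_self_iff: "submodule M U \<Longrightarrow> x \<in> C \<Longrightarrow> coset M U x = U \<longleftrightarrow> x \<in> U"
proof -
  assume a: "submodule M U" "x \<in> C"
  have "coset M U (zero M) = U"
    using submoduleD(3)[OF a(1)] unfolding coset_def by force
  then show ?thesis using coset_eq_iff[OF a zero_in] a by simp
qed

lemma coset_eq_of_mem:
  "submodule M U \<Longrightarrow> x \<in> C \<Longrightarrow> y \<in> coset M U x \<Longrightarrow> coset M U y = coset M U x"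
  using mem_coset coset_eq_iff by blast

text \<open>On \<open>T\<close> the coset modulo \<open>U\<close> determines the coset modulo
  \<open>U'\<close>. Only differences of elements of \<open>T\<close> are tested, which covers both
  an enlargement of \<open>U\<close> and the passage from \<open>Q\<close> to
  \<open>Q \<inter> N\<close> when \<open>T\<close> is \<open>N\<close>.\<close>

lemma finite_coset_mono:
  assumes "finite (coset M U ` T)" "submodule M U" "submodule M U'" "T \<subseteq> C"
    and "\<And>x. x \<in> U \<Longrightarrow> (\<exists>y\<in>T. \<exists>z\<in>T. x = y \<oplus> \<ominus> z) \<Longrightarrow> x \<in> U'"
  shows "finite (coset M U' ` T)"
proof (rule finite_image_factor[OF assms(1)])
  fix x y assume xy: "x \<in> T" "y \<in> T" "coset M U x = coset M U y"
  then have C: "x \<in> C" "y \<in> C" using assms(4) by auto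
  have "x \<oplus> \<ominus> y \<in> U" using xy(3) coset_eq_iff[OF assms(2) C] by simp
  then have "x \<oplus> \<ominus> y \<in> U'" by (rule assms(5)) (use xy(1,2) in blast)
  then show "coset M U' x = coset M U' y"
    using coset_eq_iff[OF assms(3) C] by simp
qed

text \<open>Two cosets with a common point coincide. This is what makes the open sets of the
  quotient closed under intersection.\<close>

lemma Union_cosets_Int:
  assumes U: "submodule M U" and "S \<subseteq> coset M U ` C" "T \<subseteq> coset M U ` C"
  shows "\<Union>(S \<inter> T) = \<Union>S \<inter> \<Union>T"
proof
  show "\<Union>S \<inter> \<Union>T \<subseteq> \<Union>(S \<inter> T)"
  proof
    fix z assume "z \<in> \<Union>S \<inter> \<Union>T"
    then obtain A B where AB: "A \<in> S" "B \<in> T" "z \<in> A" "z \<in> B" by blast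
    from subsetD[OF assms(2) AB(1)] obtain x where x: "A = coset M U x" "x \<in> C" by (rule imageE)
    from subsetD[OF assms(3) AB(2)] obtain y where y: "B = coset M U y" "y \<in> C" by (rule imageE)
    have "coset M U z = A" "coset M U z = B"
      using coset_eq_of_mem[OF U x(2)] coset_eq_of_mem[OF U y(2)] AB(3,4) unfolding x(1) y(1) by blast+
    then have "A \<in> S \<inter> T" using AB(1,2) by simp
    then show "z \<in> \<Union>(S \<inter> T)" using AB(3) by (rule UnionI)
  qed
qed (rule Union_Int_subset)

section \<open>The quotient module and its topology\<close>

lemma carrier_quot [simp]: "carrier (quot M U) = coset M U ` C"
  by (simp add: quot_def)

lemma zero_quot [simp]: "zero (quot M U) = U"
  by (simp add: quot_def)

text \<open>The definition of \<open>quot\<close> passes a predicate to \<open>topology\<close>; the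
  predicate can be recovered only after it is shown to satisfy \<open>istopology\<close>.\<close>

lemma openin_quot:
  assumes U: "submodule M U"
  shows "openin (top (quot M U)) S \<longleftrightarrow> S \<subseteq> coset M U ` C \<and> openin (top M) (\<Union>S)"
proof -
  define P where "P = (\<lambda>S. S \<subseteq> coset M U ` C \<and> openin (top M) (\<Union>S))"
  have "istopology P"
    unfolding istopology_def P_def
  proof (rule conjI; clarify)
    fix S T assume a: "S \<subseteq> coset M U ` C" "openin (top M) (\<Union>S)"
        "T \<subseteq> coset M U ` C" "openin (top M) (\<Union>T)"
    then have "openin (top M) (\<Union>(S \<inter> T))"
      using Union_cosets_Int[OF U] openin_Int by metis
    then show "S \<inter> T \<subseteq> coset M U ` C \<and> openin (top M) (\<Union>(S \<inter> T))"
      using a by blast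
  next
    fix \<K> assume a: "\<forall>K\<in>\<K>. K \<subseteq> coset M U ` C \<and> openin (top M) (\<Union>K)"
    have "\<Union>(\<Union>\<K>) = \<Union>(Union ` \<K>)" by blast
    moreover have "openin (top M) (\<Union>(Union ` \<K>))"
      using a by (intro openin_Union) auto
    ultimately show "\<Union>\<K> \<subseteq> coset M U ` C \<and> openin (top M) (\<Union>(\<Union>\<K>))"
      using a by auto
  qed
  then have "openin (topology P) = P" by (rule topology_inverse')
  moreover have "top (quot M U) = topology P" by (simp only: quot_def lcmod.simps P_def)
  ultimately show ?thesis by (simp only: P_def)
qed

lemma Union_coset_image:
  assumes "submodule M U" "submodule M T" "U \<subseteq> T"
  shows "\<Union>(coset M U ` T) = T"
proof
  show "\<Union>(coset M U ` T) \<subseteq> T"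
    using assms(3) submoduleD(4)[OF assms(2)] unfolding coset_def by blast
  show "T \<subseteq> \<Union>(coset M U ` T)"
    using self_in_coset[OF assms(1)] submoduleD(3)[OF assms(2)] by blast
qed

lemma Union_coset_carrier: "submodule M U \<Longrightarrow> \<Union>(coset M U ` C) = C"
  by (rule Union_coset_image[OF _ submodule_carrier submoduleD(1)])

lemma add_quot:
  assumes U: "submodule M U" and "x \<in> C" "y \<in> C"
  shows "add (quot M U) (coset M U x) (coset M U y) = coset M U (x \<oplus> y)"
proof -
  have "{p \<oplus> q |p q. p \<in> coset M U x \<and> q \<in> coset M U y} = coset M U (x \<oplus> y)" (is "?L = ?R")
  proof
    show "?L \<subseteq> ?R"
    proof clarify
      fix p q assume "p \<in> coset M U x" "q \<in> coset M U y"
      then have pq: "p \<in> C" "q \<in> C" "p \<oplus> \<ominus> x \<in> U" "q \<oplus> \<ominus> y \<in> U"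
        unfolding mem_coset[OF U assms(2)] mem_coset[OF U assms(3)] by blast+
      have "(p \<oplus> q) \<oplus> \<ominus> (x \<oplus> y) = (p \<oplus> \<ominus> x) \<oplus> (q \<oplus> \<ominus> y)"
        using pq assms by (simp add: neg_sum add_ac)
      also have "\<dots> \<in> U" by (rule submoduleD(4)[OF U pq(3,4)])
      finally show "p \<oplus> q \<in> ?R" using pq assms by (simp add: mem_coset)
    qed
    show "?R \<subseteq> ?L"
    proof
      fix z assume "z \<in> ?R"
      then obtain u where u: "u \<in> U" "z = (x \<oplus> y) \<oplus> u" by (auto simp: coset_def)
      then have "z = x \<oplus> (y \<oplus> u)" using add_assoc[OF assms(2,3)] submoduleD(3)[OF U] by simp
      moreover have "y \<oplus> u \<in> coset M U y" using u by (auto simp: coset_def)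
      ultimately show "z \<in> ?L" using self_in_coset assms by blast
    qed
  qed
  then show ?thesis by (simp add: quot_def)
qed

lemma neg_quot:
  assumes U: "submodule M U" and "x \<in> C"
  shows "neg (quot M U) (coset M U x) = coset M U (\<ominus> x)"
proof -
  have sub: "neg M ` coset M U x \<subseteq> coset M U (\<ominus> x)" if "x \<in> C" for x
  proof clarify
    fix p assume "p \<in> coset M U x"
    then have "p \<in> C" "p \<oplus> \<ominus> x \<in> U" unfolding mem_coset[OF U that] by blast+
    moreover from this have "\<ominus> (p \<oplus> \<ominus> x) \<in> U" by (intro submoduleD(5)[OF U])
    ultimately show "\<ominus> p \<in> coset M U (\<ominus> x)" using that U by (simp add: mem_coset neg_sum)
  qed
  \<comment> \<open>The reverse inclusion is \<open>sub\<close> at \<open>\<ominus> x\<close>,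
    because negation is an involution.\<close>
  have "z \<in> neg M ` coset M U x" if "z \<in> coset M U (\<ominus> x)" for z
  proof -
    have "\<ominus> z \<in> coset M U x" using subsetD[OF sub[of "\<ominus> x"] imageI[OF that]] assms(2) by simp
    moreover have "z \<in> C" using that coset_subset[OF U neg_in[OF assms(2)]] by blast
    ultimately show ?thesis by (metis image_eqI neg_neg)
  qed
  then have "neg M ` coset M U x = coset M U (\<ominus> x)" using sub[OF assms(2)] by blast
  then show ?thesis by (simp add: quot_def)
qed

lemma act_quot:
  assumes U: "submodule M U" and "x \<in> C"
  shows "act (quot M U) a (coset M U x) = coset M U (act M a x)"
proof -
  have sub: "act M a ` coset M U x \<subseteq> coset M U (act M a x)" if "x \<in> C" for x a
  proof clarify
    fix p assume "p \<in> coset M U x"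
    then have "p \<in> C" "p \<oplus> \<ominus> x \<in> U" unfolding mem_coset[OF U that] by blast+
    moreover from this have "act M a (p \<oplus> \<ominus> x) \<in> U" by (intro submoduleD(6)[OF U])
    ultimately show "act M a p \<in> coset M U (act M a x)"
      using that U by (simp add: mem_coset act_add act_neg)
  qed
  \<comment> \<open>The reverse inclusion is \<open>sub\<close> for the inverse automorphism, the
    action of \<open>- a\<close>.\<close>
  have "z \<in> act M a ` coset M U x" if "z \<in> coset M U (act M a x)" for z
  proof -
    have "act M (- a) z \<in> coset M U (act M (- a) (act M a x))"
      using subsetD[OF sub[of "act M a x" "- a"] imageI[OF that]] assms(2) by simp
    then have "act M (- a) z \<in> coset M U x"
      using assms act_act[of x "- a" a] by simp
    moreover have "z \<in> C" using that coset_subset[OF U act_in[OF assms(2)]] by blast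
    ultimately show ?thesis by (metis image_eqI act_uminus)
  qed
  then have "act M a ` coset M U x = coset M U (act M a x)" using sub[OF assms(2)] by blast
  then show ?thesis by (simp add: quot_def)
qed

lemma abgroup_action_quot:
  assumes U: "submodule M U"
  shows "abgroup_action (quot M U)"
proof
  note [simp] = add_quot[OF U] neg_quot[OF U] act_quot[OF U]
  \<comment> \<open>The zero of \<open>quot\<close> is given as \<open>U\<close> itself; it has to
    be recognised as a coset before the rules for the operations apply.\<close>
  have U0: "coset M U (zero M) = U"
    using coset_eq_self_iff[OF U zero_in] submoduleD(2)[OF U] by simp
  show "zero (quot M U) \<in> carrier (quot M U)"
    using U0 zero_in by (metis carrier_quot zero_quot image_eqI)
  show "topspace (top (quot M U)) = carrier (quot M U)"
  proof -
    have "openin (top (quot M U)) (coset M U ` C)"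
      using Union_coset_carrier[OF U] openin_topspace[of "top M"]
      by (simp add: openin_quot[OF U] topspace_eq)
    then have "coset M U ` C \<subseteq> topspace (top (quot M U))" by (rule openin_subset)
    moreover have "topspace (top (quot M U)) \<subseteq> coset M U ` C"
      using openin_topspace[of "top (quot M U)"] unfolding openin_quot[OF U] by blast
    ultimately show ?thesis by simp
  qed
  fix c d e a b
  assume c: "c \<in> carrier (quot M U)"
  then obtain x where x: "x \<in> C" "c = coset M U x" by auto
  show "neg (quot M U) c \<in> carrier (quot M U)" using x by simp
  show "act (quot M U) a c \<in> carrier (quot M U)" using x by simp
  show "act (quot M U) 0 c = c" using x by simp
  show "act (quot M U) (a + b) c = act (quot M U) a (act (quot M U) b c)"
    using x by (simp add: act_act)
  have "add (quot M U) (coset M U (zero M)) c = c" using x by simp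
  then show "add (quot M U) (zero (quot M U)) c = c" by (simp only: U0 zero_quot)
  show "add (quot M U) (neg (quot M U) c) c = zero (quot M U)"
    using x U0 by simp
  assume "d \<in> carrier (quot M U)"
  then obtain y where y: "y \<in> C" "d = coset M U y" by auto
  show "add (quot M U) c d \<in> carrier (quot M U)" using x y by simp
  show "add (quot M U) c d = add (quot M U) d c" using x y by (simp add: add_comm)
  show "act (quot M U) a (add (quot M U) c d) = add (quot M U) (act (quot M U) a c) (act (quot M U) a d)"
    using x y by (simp add: act_add)
  assume "e \<in> carrier (quot M U)"
  then obtain z where z: "z \<in> C" "e = coset M U z" by auto
  show "add (quot M U) (add (quot M U) c d) e = add (quot M U) c (add (quot M U) d e)"
    using x y z by (simp add: add_assoc)
qed

lemma submodule_coset_image: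
  assumes U: "submodule M U" and T: "submodule M T" and "U \<subseteq> T"
  shows "submodule (quot M U) (coset M U ` T)"
proof -
  have "coset M U (zero M) = U"
    using coset_eq_self_iff[OF U zero_in] submoduleD(2)[OF U] by simp
  then have "U \<in> coset M U ` T" using submoduleD(2)[OF T] by (metis image_eqI)
  then show ?thesis
    unfolding submodule_def zero_quot carrier_quot
  proof (intro conjI ballI allI)
    show "coset M U ` T \<subseteq> coset M U ` C" using submoduleD(1)[OF T] by (rule image_mono)
    fix c a assume "c \<in> coset M U ` T"
    then obtain x where x: "x \<in> T" "c = coset M U x" by blast
    then have xC: "x \<in> C" using submoduleD(3)[OF T] by blast
    show "neg (quot M U) c \<in> coset M U ` T"
      unfolding x(2) neg_quot[OF U xC] by (intro imageI submoduleD(5)[OF T] x(1))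
    show "act (quot M U) a c \<in> coset M U ` T"
      unfolding x(2) act_quot[OF U xC] by (intro imageI submoduleD(6)[OF T] x(1))
    fix d assume "d \<in> coset M U ` T"
    then obtain y where y: "y \<in> T" "d = coset M U y" by blast
    then have yC: "y \<in> C" using submoduleD(3)[OF T] by blast
    show "add (quot M U) c d \<in> coset M U ` T"
      unfolding x(2) y(2) add_quot[OF U xC yC] by (intro imageI submoduleD(4)[OF T] x(1) y(1))
  qed
qed

text \<open>The correspondence theorem: a submodule \<open>S\<close> of the quotient is recovered
  from its preimage, which is \<open>\<Union>S\<close> because the elements of \<open>S\<close> are
  cosets.\<close>

lemma submodule_quotD:
  assumes U: "submodule M U" and S: "submodule (quot M U) S"
  shows "submodule M (\<Union>S)" "U \<subseteq> \<Union>S" "coset M U ` \<Union>S = S"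
    and "\<And>x. x \<in> C \<Longrightarrow> x \<in> \<Union>S \<longleftrightarrow> coset M U x \<in> S"
proof -
  have S': "S \<subseteq> coset M U ` C" "U \<in> S"
    using S unfolding submodule_def carrier_quot zero_quot by blast+
  have SD: "neg (quot M U) c \<in> S" "act (quot M U) a c \<in> S" if "c \<in> S" for c a
    using S that unfolding submodule_def by blast+
  have Sadd: "add (quot M U) c d \<in> S" if "c \<in> S" "d \<in> S" for c d
    using S that unfolding submodule_def by blast
  show mem: "x \<in> \<Union>S \<longleftrightarrow> coset M U x \<in> S" if x: "x \<in> C" for x
  proof
    assume "x \<in> \<Union>S"
    then obtain A where A: "A \<in> S" "x \<in> A" by (rule UnionE)
    from subsetD[OF S'(1) A(1)] obtain y where y: "A = coset M U y" "y \<in> C" by (rule imageE)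
    have "coset M U x = A"
      using coset_eq_of_mem[OF U y(2)] A(2) unfolding y(1) by blast
    then show "coset M U x \<in> S" using A(1) by simp
  next
    assume "coset M U x \<in> S"
    then show "x \<in> \<Union>S" using self_in_coset[OF U x] by (rule UnionI)
  qed
  have sub: "\<Union>S \<subseteq> C"
    using Union_mono[OF S'(1)] unfolding Union_coset_carrier[OF U] .
  show "U \<subseteq> \<Union>S" using S'(2) by (rule Union_upper)
  show "coset M U ` \<Union>S = S"
  proof
    show "coset M U ` \<Union>S \<subseteq> S" using mem sub by (metis image_subsetI subsetD)
    show "S \<subseteq> coset M U ` \<Union>S"
    proof
      fix A assume A: "A \<in> S"
      from subsetD[OF S'(1) A] obtain y where y: "A = coset M U y" "y \<in> C" by (rule imageE)
      then have "y \<in> \<Union>S" using mem A by simp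
      then show "A \<in> coset M U ` \<Union>S" unfolding y(1) by (rule imageI)
    qed
  qed
  show "submodule M (\<Union>S)"
    unfolding submodule_def
  proof (intro conjI ballI allI)
    show "\<Union>S \<subseteq> C" by fact
    show "zero M \<in> \<Union>S" using S'(2) submoduleD(2)[OF U] by (rule UnionI)
    fix x a assume x: "x \<in> \<Union>S"
    have xC: "x \<in> C" using sub x by (rule subsetD)
    have xS: "coset M U x \<in> S" using mem[OF xC] x by simp
    show "\<ominus> x \<in> \<Union>S"
      using SD(1)[OF xS] neg_quot[OF U xC] mem[OF neg_in[OF xC]] by simp
    show "act M a x \<in> \<Union>S"
      using SD(2)[OF xS, of a] act_quot[OF U xC, of a] mem[OF act_in[OF xC]] by simp
    fix y assume y: "y \<in> \<Union>S"
    have yC: "y \<in> C" using sub y by (rule subsetD)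
    have yS: "coset M U y \<in> S" using mem[OF yC] y by simp
    show "x \<oplus> y \<in> \<Union>S"
      using Sadd[OF xS yS] add_quot[OF U xC yC] mem[OF add_in[OF xC yC]] by simp
  qed
qed

lemma submodule_submod:
  "submodule M N \<Longrightarrow> submodule (submod M N) U \<longleftrightarrow> submodule M U \<and> U \<subseteq> N"
  by (auto simp: submodule_def submod_def)

text \<open>The submodules \<open>T\<close> and \<open>T + U\<close> have the same image modulo
  \<open>U\<close>. If it is finite, it is a finite submodule of the quotient, hence zero, and so
  \<open>T + U = U\<close>.\<close>

lemma purely_discrete_quotD:
  assumes U: "submodule M U" and "purely_discrete (quot M U)"
    and T: "submodule M T" "finite (coset M U ` T)"
  shows "T \<subseteq> U"
proof -
  let ?T = "setsum T U"
  have T': "submodule M ?T" "U \<subseteq> ?T" "T \<subseteq> ?T"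
    by (intro submodule_setsum setsum_upper T(1) U)+
  have "coset M U ` ?T \<subseteq> coset M U ` T"
  proof clarify
    fix z assume "z \<in> ?T"
    then obtain x y where z: "z = x \<oplus> y" "x \<in> T" "y \<in> U" by (rule setsumE)
    then have "x \<in> C" "y \<in> C" using submoduleD(3) T(1) U by blast+
    then have "coset M U z = coset M U x"
      using z U by (simp add: coset_eq_iff add_ac)
    then show "coset M U z \<in> coset M U ` T" using z by blast
  qed
  then have "finite (coset M U ` ?T)" using T(2) finite_subset by blast
  then have "coset M U ` ?T = {U}"
    using assms(2) submodule_coset_image[OF U T'(1,2)] by (simp add: purely_discrete_def)
  then have "?T = U" using Union_coset_image[OF U T'(1,2)] by simp
  then show ?thesis using T' by simp
qed

text \<open>By the correspondence theorem it suffices to test submodules \<open>T\<close> above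
  \<open>U\<close>. Openness is required of every coset, since translations are not known to be
  continuous at this level.\<close>

lemma purely_discrete_quotI:
  assumes U: "submodule M U" and open_cosets: "\<And>x. x \<in> C \<Longrightarrow> openin (top M) (coset M U x)"
    and *: "\<And>T. submodule M T \<Longrightarrow> U \<subseteq> T \<Longrightarrow> finite (coset M U ` T) \<Longrightarrow> T \<subseteq> U"
  shows "purely_discrete (quot M U)"
proof -
  have "openin (top (quot M U)) S \<longleftrightarrow> S \<subseteq> coset M U ` C" for S
    unfolding openin_quot[OF U] using open_cosets by (auto intro!: openin_Union)
  then have "top (quot M U) = discrete_topology (coset M U ` C)"
    by (simp add: topology_eq)
  moreover have "S = {U}" if S: "submodule (quot M U) S" "finite S" for S
  proof -
    note Q = submodule_quotD[OF U S(1)]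
    have eq: "\<Union>S = U" using *[OF Q(1,2)] Q(2,3) S(2) by auto
    have "coset M U ` \<Union>S = {U}"
      unfolding eq using coset_eq_self_iff[OF U] submoduleD(2,3)[OF U] by auto
    then show ?thesis using Q(3) by simp
  qed
  ultimately show ?thesis by (simp add: purely_discrete_def)
qed

lemma coset_carrier: "x \<in> C \<Longrightarrow> coset M C x = C"
  using coset_eq_self_iff submodule_carrier by blast

section \<open>The radicals as submodules\<close>

lemma purely_discrete_quot_carrier: "purely_discrete (quot M C)"
proof (rule purely_discrete_quotI)
  show "openin (top M) (coset M C x)" if "x \<in> C" for x
    using that coset_carrier topspace_eq openin_topspace by metis
qed (use submoduleD(1) in simp_all)

text \<open>Keeps the family defining \<open>Omega_sharp M\<close> nonempty, so that its
  intersection is a subset of \<open>C\<close> and not the whole type.\<close>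

lemma carrier_codiscrete:
  "C \<in> {U. submodule M U \<and> openin (top M) U \<and> purely_discrete (quot M U)}"
  using openin_topspace[of "top M"] purely_discrete_quot_carrier by (simp add: topspace_eq)

lemma Omega_sharp_subset: "Omega_sharp M \<subseteq> C"
  and submodule_Omega_sharp: "submodule M (Omega_sharp M)"
proof -
  let ?F = "{U. submodule M U \<and> openin (top M) U \<and> purely_discrete (quot M U)}"
  show "Omega_sharp M \<subseteq> C"
    unfolding Omega_sharp_def using carrier_codiscrete by (rule Inter_lower)
  have "?F \<noteq> {}" using carrier_codiscrete by (metis empty_iff)
  then show "submodule M (Omega_sharp M)"
    unfolding Omega_sharp_def by (rule submodule_Inter) simp
qed

lemma submodule_W_flat: "submodule M (W_flat M)"
  unfolding W_flat_def
proof (rule submodule_Inter)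
  have "C \<in> {S. submodule M S \<and> (\<forall>N. submodule M N \<and> compact_parafinite (submod M N) \<longrightarrow> N \<subseteq> S)}"
    using submoduleD(1) by simp
  then show "{S. submodule M S \<and> (\<forall>N. submodule M N \<and> compact_parafinite (submod M N) \<longrightarrow> N \<subseteq> S)} \<noteq> {}"
    by blast
qed simp

lemma W_flat_upper: "submodule M N \<Longrightarrow> compact_parafinite (submod M N) \<Longrightarrow> N \<subseteq> W_flat M"
  unfolding W_flat_def by blast

lemma W_flat_least:
  "submodule M S \<Longrightarrow> (\<And>N. submodule M N \<Longrightarrow> compact_parafinite (submod M N) \<Longrightarrow> N \<subseteq> S) \<Longrightarrow> W_flat M \<subseteq> S"
  unfolding W_flat_def by blast

text \<open>Submodules, cosets and the topology of \<open>N\<close> are all induced from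
  \<open>M\<close>, so the condition can be tested inside \<open>M\<close> without forming
  \<open>submod M N\<close>.\<close>

lemma compact_parafinite_submod:
  assumes N: "submodule M N"
  shows "compact_parafinite (submod M N) \<longleftrightarrow> compactin (top M) N \<and>
    (\<forall>U. submodule M U \<and> U \<subseteq> N \<and> closedin (subtopology (top M) N) U \<and> finite (coset M U ` N) \<longrightarrow> U = N)"
proof -
  have [simp]: "carrier (quot (submod M N) U) = coset M U ` N" for U
    by (simp add: quot_def)
  show ?thesis
    unfolding compact_parafinite_def submodule_submod[OF N]
    using submoduleD(1)[OF N] by (auto simp: compactin_subspace topspace_eq)
qed

text \<open>The quotient of \<open>N\<close> by \<open>Q \<inter> N\<close> embeds into the image of
  \<open>N\<close> modulo \<open>Q\<close>. It is therefore a finite quotient of a parafinite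
  module, and \<open>Q \<inter> N = N\<close>.\<close>

lemma compact_parafinite_finite_index:
  assumes N: "submodule M N" "compact_parafinite (submod M N)"
    and Q: "submodule M Q" "closedin (subtopology (top M) N) (Q \<inter> N)" "finite (coset M Q ` N)"
  shows "N \<subseteq> Q"
proof -
  have QN: "submodule M (Q \<inter> N)" using Q(1) N(1) by (rule submodule_Int)
  have "finite (coset M (Q \<inter> N) ` N)"
  proof (rule finite_coset_mono[OF Q(3,1) QN submoduleD(1)[OF N(1)]])
    fix x assume "x \<in> Q" and "\<exists>y\<in>N. \<exists>z\<in>N. x = y \<oplus> \<ominus> z"
    then show "x \<in> Q \<inter> N" using submoduleD(4,5)[OF N(1)] by blast
  qed
  then have "Q \<inter> N = N"
    using N(2) Q(2) QN unfolding compact_parafinite_submod[OF N(1)] by (metis Int_lower2)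
  then show ?thesis by blast
qed

text \<open>The third isomorphism theorem on the level of cosets: the quotient of \<open>M/W\<close>
  by \<open>S\<close> separates points of \<open>M\<close> exactly as the quotient by the preimage
  \<open>\<Union>S\<close> does.\<close>

lemma coset_quot_eq_iff:
  assumes W: "submodule M W" and S: "submodule (quot M W) S" and "x \<in> C" "y \<in> C"
  shows "coset (quot M W) S (coset M W x) = coset (quot M W) S (coset M W y)
    \<longleftrightarrow> coset M (\<Union>S) x = coset M (\<Union>S) y"
proof -
  interpret Q: abgroup_action "quot M W" using W by (rule abgroup_action_quot)
  note US = submodule_quotD[OF W S]
  have "coset (quot M W) S (coset M W x) = coset (quot M W) S (coset M W y)
      \<longleftrightarrow> add (quot M W) (coset M W x) (neg (quot M W) (coset M W y)) \<in> S"
    using assms(3,4) by (intro Q.coset_eq_iff S) simp_all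
  also have "\<dots> \<longleftrightarrow> coset M W (x \<oplus> \<ominus> y) \<in> S"
    using assms(3,4) by (simp add: neg_quot[OF W] add_quot[OF W])
  also have "\<dots> \<longleftrightarrow> x \<oplus> \<ominus> y \<in> \<Union>S" using assms(3,4) US(4)[of "x \<oplus> \<ominus> y"] by simp
  also have "\<dots> \<longleftrightarrow> coset M (\<Union>S) x = coset M (\<Union>S) y"
    using coset_eq_iff[OF US(1) assms(3,4)] by simp
  finally show ?thesis .
qed

lemma finite_coset_quot_iff:
  assumes W: "submodule M W" and S: "submodule (quot M W) S" and "T \<subseteq> C"
  shows "finite (coset (quot M W) S ` coset M W ` T) \<longleftrightarrow> finite (coset M (\<Union>S) ` T)"
proof -
  have *: "coset (quot M W) S (coset M W x) = coset (quot M W) S (coset M W y)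
      \<longleftrightarrow> coset M (\<Union>S) x = coset M (\<Union>S) y" if "x \<in> T" "y \<in> T" for x y
    using that assms(3) by (intro coset_quot_eq_iff[OF W S]) blast+
  show ?thesis
    unfolding image_image
  proof
    assume "finite ((\<lambda>x. coset (quot M W) S (coset M W x)) ` T)"
    then show "finite (coset M (\<Union>S) ` T)" by (rule finite_image_factor) (use * in blast)
  next
    assume "finite (coset M (\<Union>S) ` T)"
    then show "finite ((\<lambda>x. coset (quot M W) S (coset M W x)) ` T)"
      by (rule finite_image_factor) (use * in blast)
  qed
qed

end

section \<open>Topological modules\<close>

lemma compact_symmetrized:
  fixes K :: "'b::topological_ab_group_add set"
  shows "compact K \<Longrightarrow> compact (K \<union> uminus ` K)"
  by (intro compact_Un compact_continuous_image continuous_on_minus continuous_on_id)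

text \<open>Local compactness stays outside, so that every submodule with the subspace topology is
  again an instance; it is assumed only in the lemmas that call for a compact neighbourhood.\<close>

locale topological_module = abgroup_action M
  for M :: "('a, 'b::{topological_ab_group_add, t2_space}) lcmod" +
  assumes cont_add: "continuous_map (prod_topology (top M) (top M)) (top M) (\<lambda>(x, y). add M x y)"
    and cont_neg: "continuous_map (top M) (top M) (neg M)"
    and cont_act: "continuous_map (prod_topology euclidean (top M)) (top M) (\<lambda>(a, x). act M a x)"
    and Hausdorff: "Hausdorff_space (top M)"
begin

section \<open>Translations, open submodules and compact sets\<close>

lemma cont_translate:
  assumes "x \<in> C"
  shows "continuous_map (top M) (top M) (\<lambda>y. x \<oplus> y)"
proof -
  have "continuous_map (top M) (prod_topology (top M) (top M)) (\<lambda>y. (x, y))"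
    using assms by (intro continuous_map_pairedI) (simp_all add: topspace_eq)
  from continuous_map_compose[OF this cont_add] show ?thesis by (simp add: o_def)
qed

lemma cont_act_left: "continuous_map (top M) (top M) (act M a)"
proof -
  have "continuous_map (top M) (prod_topology euclidean (top M)) (\<lambda>y. (a, y))"
    by (intro continuous_map_pairedI) simp_all
  from continuous_map_compose[OF this cont_act] show ?thesis by (simp add: o_def)
qed

text \<open>The translate of \<open>P\<close> by \<open>x\<close> is the preimage of
  \<open>P\<close> under translation by \<open>\<ominus> x\<close>.\<close>

lemma openin_translate:
  assumes x: "x \<in> C" and P: "openin (top M) P"
  shows "openin (top M) ((\<lambda>y. x \<oplus> y) ` P)"
proof -
  have PC: "P \<subseteq> C" using openin_subset[OF P] by (simp add: topspace_eq)
  have "(\<lambda>y. x \<oplus> y) ` P = {z \<in> topspace (top M). \<ominus> x \<oplus> z \<in> P}" (is "?L = ?R")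
  proof
    show "?L \<subseteq> ?R"
    proof
      fix z assume "z \<in> ?L"
      then obtain p where p: "z = x \<oplus> p" "p \<in> P" by (rule imageE)
      then have "p \<in> C" using PC by blast
      then show "z \<in> ?R" using p x by (simp add: topspace_eq)
    qed
    show "?R \<subseteq> ?L"
    proof
      fix z assume "z \<in> ?R"
      then have z: "z \<in> C" "\<ominus> x \<oplus> z \<in> P" by (simp_all add: topspace_eq)
      then have "z = x \<oplus> (\<ominus> x \<oplus> z)" using x by simp
      then show "z \<in> ?L" using z(2) by (rule image_eqI)
    qed
  qed
  also have "openin (top M) \<dots>"
    using cont_translate[OF neg_in[OF x]] P by (rule openin_continuous_map_preimage)
  finally show ?thesis .
qed

lemma openin_setsum:
  assumes "S \<subseteq> C" "openin (top M) P"
  shows "openin (top M) (setsum S P)"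
proof -
  have "setsum S P = (\<Union>x\<in>S. (\<lambda>y. x \<oplus> y) ` P)"
    unfolding setsum_def by blast
  moreover have "openin (top M) ((\<lambda>y. x \<oplus> y) ` P)" if "x \<in> S" for x
    using that assms(1) by (intro openin_translate assms(2)) blast
  ultimately show ?thesis by (simp only:) (rule openin_Union, blast)
qed

text \<open>A submodule \<open>S\<close> containing an open neighbourhood \<open>P\<close> of zero
  equals \<open>S + P\<close>, a union of translates of \<open>P\<close>.\<close>

lemma openin_submodule:
  assumes S: "submodule M S" and P: "openin (top M) P" "zero M \<in> P" "P \<subseteq> S"
  shows "openin (top M) S"
proof -
  have "setsum S P \<subseteq> S"
  proof
    fix z assume "z \<in> setsum S P"
    then obtain x y where "z = x \<oplus> y" "x \<in> S" "y \<in> P" by (rule setsumE)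
    then show "z \<in> S" using submoduleD(4)[OF S] P(3) by blast
  qed
  moreover have "S \<subseteq> setsum S P"
  proof
    fix x assume x: "x \<in> S"
    then have "x \<in> C" by (rule submoduleD(3)[OF S])
    then show "x \<in> setsum S P" using setsumI[OF x P(2)] by simp
  qed
  ultimately show ?thesis using openin_setsum[OF submoduleD(1)[OF S] P(1)] by simp
qed

lemma openin_coset:
  "openin (top M) U \<Longrightarrow> x \<in> C \<Longrightarrow> openin (top M) (coset M U x)"
  unfolding coset_def by (rule openin_translate)

text \<open>The complement of \<open>U\<close> is a union of cosets of \<open>U\<close>, each of
  them open.\<close>

lemma closedin_open_submodule:
  assumes U: "submodule M U" "openin (top M) U"
  shows "closedin (top M) U"
proof -
  have "C - U = \<Union>(coset M U ` (C - U))"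
  proof
    show "C - U \<subseteq> \<Union>(coset M U ` (C - U))" using self_in_coset[OF U(1)] by blast
    show "\<Union>(coset M U ` (C - U)) \<subseteq> C - U"
    proof clarify
      fix x z assume x: "x \<in> C" "x \<notin> U" and z: "z \<in> coset M U x"
      have zC: "z \<in> C" using z coset_subset[OF U(1) x(1)] by blast
      have "coset M U z = coset M U x" using coset_eq_of_mem[OF U(1) x(1) z] .
      then show "z \<in> C - U"
        using coset_eq_self_iff[OF U(1) x(1)] coset_eq_self_iff[OF U(1) zC] x(2) zC by simp
    qed
  qed
  moreover have "openin (top M) (\<Union>(coset M U ` (C - U)))"
    using openin_coset[OF U(2)] by (intro openin_Union) blast
  ultimately show ?thesis
    using submoduleD(1)[OF U(1)] by (simp add: closedin_def topspace_eq)
qed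

lemma compactin_setsum:
  assumes "compactin (top M) S" "compactin (top M) T"
  shows "compactin (top M) (setsum S T)"
proof -
  have "compactin (prod_topology (top M) (top M)) (S \<times> T)"
    using assms by (simp add: compactin_Times)
  from image_compactin[OF this cont_add]
  have "compactin (top M) ((\<lambda>(x, y). x \<oplus> y) ` (S \<times> T))" .
  moreover have "(\<lambda>(x, y). x \<oplus> y) ` (S \<times> T) = setsum S T"
    unfolding setsum_def by force
  ultimately show ?thesis by simp
qed

text \<open>The cosets of \<open>U\<close> are pairwise disjoint open sets covering
  \<open>V\<close>; a finite subcover must contain every coset that meets \<open>V\<close>.\<close>

lemma finite_coset_compactin:
  assumes U: "submodule M U" "openin (top M) U" and V: "compactin (top M) V"
  shows "finite (coset M U ` V)"
proof -
  have VC: "V \<subseteq> C" using compactin_subset_topspace[OF V] by (simp add: topspace_eq)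
  have "\<And>B. B \<in> coset M U ` C \<Longrightarrow> openin (top M) B" using openin_coset[OF U(2)] by blast
  moreover have "V \<subseteq> \<Union>(coset M U ` C)" using VC Union_coset_carrier[OF U(1)] by simp
  ultimately obtain \<F> where F: "finite \<F>" "\<F> \<subseteq> coset M U ` C" "V \<subseteq> \<Union>\<F>"
    using V by (meson compactinD)
  have "coset M U ` V \<subseteq> \<F>"
  proof clarify
    fix v assume "v \<in> V"
    then obtain A where A: "A \<in> \<F>" "v \<in> A" using F(3) by blast
    from subsetD[OF F(2) A(1)] obtain y where y: "A = coset M U y" "y \<in> C" by (rule imageE)
    have "coset M U v = A" using coset_eq_of_mem[OF U(1) y(2)] A(2) unfolding y(1) by blast
    then show "coset M U v \<in> \<F>" using A(1) by simp
  qed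
  then show ?thesis using F(1) by (rule finite_subset)
qed

lemma closedin_compactin: "compactin (top M) S \<Longrightarrow> closedin (top M) S"
  using compactin_imp_closedin[OF Hausdorff] .

text \<open>A continuous operation that preserves \<open>S\<close> also preserves its closure. For
  addition this is applied to \<open>S \<times> S\<close>, whose closure is the product of the
  closures.\<close>

lemma submodule_closure:
  assumes S: "submodule M S"
  shows "submodule M (top M closure_of S)"
  unfolding submodule_def
proof (intro conjI ballI allI)
  have maps: "f x \<in> top M closure_of S"
    if "continuous_map (top M) (top M) f" "f ` S \<subseteq> S" "x \<in> top M closure_of S" for f x
    using continuous_map_image_closure_subset[OF that(1), of S] closure_of_mono[OF that(2)] that(3)
    by blast
  show "top M closure_of S \<subseteq> C"
    using closure_of_subset_topspace[of "top M" S] by (simp add: topspace_eq)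
  show "zero M \<in> top M closure_of S"
    using closure_of_subset[of S "top M"] submoduleD(1,2)[OF S] by (auto simp: topspace_eq)
  fix x a assume x: "x \<in> top M closure_of S"
  show "\<ominus> x \<in> top M closure_of S"
    by (rule maps[OF cont_neg _ x]) (use submoduleD(5)[OF S] in blast)
  show "act M a x \<in> top M closure_of S"
    by (rule maps[OF cont_act_left _ x]) (use submoduleD(6)[OF S] in blast)
  fix y assume y: "y \<in> top M closure_of S"
  have "(x, y) \<in> prod_topology (top M) (top M) closure_of (S \<times> S)"
    using x y by (simp add: closure_of_Times)
  from subsetD[OF continuous_map_image_closure_subset[OF cont_add] imageI[OF this]]
  have "x \<oplus> y \<in> top M closure_of ((\<lambda>(x, y). x \<oplus> y) ` (S \<times> S))" by simp
  moreover have "(\<lambda>(x, y). x \<oplus> y) ` (S \<times> S) \<subseteq> S"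
    using submoduleD(4)[OF S] by auto
  ultimately show "x \<oplus> y \<in> top M closure_of S"
    using closure_of_mono subsetD by metis
qed

lemma small_nbhd:
  assumes Q: "openin (top M) Q" "zero M \<in> Q" and K: "compact K"
  obtains P where "openin (top M) P" "zero M \<in> P"
    "\<And>x y. x \<in> P \<Longrightarrow> y \<in> P \<Longrightarrow> x \<oplus> y \<in> Q" "\<And>x. x \<in> P \<Longrightarrow> \<ominus> x \<in> Q"
    "\<And>a x. a \<in> K \<Longrightarrow> x \<in> P \<Longrightarrow> act M a x \<in> Q"
proof -
  let ?A = "{p \<in> topspace (prod_topology (top M) (top M)). (\<lambda>(x, y). x \<oplus> y) p \<in> Q}"
  have "openin (prod_topology (top M) (top M)) ?A"
    using cont_add Q(1) by (rule openin_continuous_map_preimage)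
  moreover have "(zero M, zero M) \<in> ?A" using Q(2) by (simp add: topspace_eq)
  ultimately obtain P1 P2 where P12: "openin (top M) P1" "openin (top M) P2" "zero M \<in> P1"
      "zero M \<in> P2" "P1 \<times> P2 \<subseteq> ?A"
    unfolding openin_prod_topology_alt by meson
  let ?B = "{p \<in> topspace (prod_topology euclidean (top M)). (\<lambda>(a, x). act M a x) p \<in> Q}"
  have B: "openin (prod_topology euclidean (top M)) ?B"
    using cont_act Q(1) by (rule openin_continuous_map_preimage)
  \<comment> \<open>Zero is fixed by the action, so the open set \<open>?B\<close> contains the
    compact set \<open>K \<times> {zero M}\<close>. Wallace's theorem then yields one neighbourhood
    \<open>P3\<close> that serves all \<open>a\<close> in \<open>K\<close> at once.\<close>
  have "compactin euclidean K" using K by simp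
  moreover have "compactin (top M) {zero M}" by (simp add: topspace_eq)
  moreover have "K \<times> {zero M} \<subseteq> ?B" using Q(2) by (auto simp: topspace_eq)
  ultimately obtain A P3 where P3: "openin (top M) P3" "K \<subseteq> A" "{zero M} \<subseteq> P3" "A \<times> P3 \<subseteq> ?B"
    by (rule Wallace_theorem_prod_topology[OF _ _ B])
  let ?P4 = "{x \<in> topspace (top M). \<ominus> x \<in> Q}"
  have P4: "openin (top M) ?P4" using cont_neg Q(1) by (rule openin_continuous_map_preimage)
  show ?thesis
  proof (rule that[of "P1 \<inter> P2 \<inter> P3 \<inter> ?P4"])
    show "openin (top M) (P1 \<inter> P2 \<inter> P3 \<inter> ?P4)" using P12 P3 P4 by blast
    show "zero M \<in> P1 \<inter> P2 \<inter> P3 \<inter> ?P4" using P12 P3 Q(2) by (simp add: topspace_eq)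
    show "x \<oplus> y \<in> Q" if "x \<in> P1 \<inter> P2 \<inter> P3 \<inter> ?P4" "y \<in> P1 \<inter> P2 \<inter> P3 \<inter> ?P4" for x y
      using that subsetD[OF P12(5), of "(x, y)"] by simp
    show "act M a x \<in> Q" if "a \<in> K" "x \<in> P1 \<inter> P2 \<inter> P3 \<inter> ?P4" for a x
      using that subsetD[OF P3(4), of "(a, x)"] subsetD[OF P3(2), of a] by simp
    show "\<ominus> x \<in> Q" if "x \<in> P1 \<inter> P2 \<inter> P3 \<inter> ?P4" for x
      using that by simp
  qed
qed

text \<open>The elements \<open>a\<close> for which both \<open>a\<close> and \<open>- a\<close> map
  \<open>H\<close> into itself form a subgroup containing \<open>K\<close>. Here \<open>H\<close> is
  a mere set, because the lemma helps to prove that \<open>H\<close> is a submodule.\<close>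

lemma act_closed_of_generators:
  assumes K: "gen_subgroup K = UNIV" and H: "H \<subseteq> C"
    and "\<And>a x. a \<in> K \<union> uminus ` K \<Longrightarrow> x \<in> H \<Longrightarrow> act M a x \<in> H"
    and x: "x \<in> H"
  shows "act M a x \<in> H"
proof -
  let ?G = "{a. \<forall>x\<in>H. act M a x \<in> H \<and> act M (- a) x \<in> H}"
  have "K \<subseteq> ?G" using assms(3) by blast
  moreover have "0 \<in> ?G" using H by auto
  moreover have "\<forall>x\<in>?G. - x \<in> ?G" by simp
  moreover have "\<forall>a\<in>?G. \<forall>b\<in>?G. a + b \<in> ?G"
  proof (intro ballI CollectI)
    fix a b x assume a: "a \<in> ?G" and b: "b \<in> ?G" and x: "x \<in> H"
    have "x \<in> C" using x H by blast
    then have "act M (a + b) x = act M a (act M b x)"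
      "act M (- (a + b)) x = act M (- a) (act M (- b) x)"
      by (simp_all add: act_act[symmetric])
    then show "act M (a + b) x \<in> H \<and> act M (- (a + b)) x \<in> H" using a b x by simp
  qed
  ultimately have "gen_subgroup K \<subseteq> ?G" unfolding gen_subgroup_def by (intro Inter_lower) blast
  then show ?thesis using x unfolding K by blast
qed

text \<open>Being compact, \<open>N\<close> meets only finitely many cosets of the open submodule
  \<open>U\<close>, and \<open>U\<close> is also closed; parafiniteness then forces \<open>N\<close>
  into \<open>U\<close>.\<close>

lemma compact_parafinite_subset_open:
  assumes N: "submodule M N" "compact_parafinite (submod M N)"
    and U: "submodule M U" "openin (top M) U"
  shows "finite (coset M U ` N)" "N \<subseteq> U"
proof -
  have "compactin (top M) N" using N compact_parafinite_submod[OF N(1)] by blast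
  then show fin: "finite (coset M U ` N)" using finite_coset_compactin[OF U] by blast
  have "closedin (subtopology (top M) N) (U \<inter> N)"
    using closedin_open_submodule[OF U] unfolding closedin_subtopology by blast
  then show "N \<subseteq> U" using compact_parafinite_finite_index[OF N U(1)] fin by blast
qed

lemma topological_module_submod:
  assumes N: "submodule M N"
  shows "topological_module (submod M N)"
proof
  have NC: "x \<in> N \<Longrightarrow> x \<in> C" for x by (rule submoduleD(3)[OF N])
  fix x y z a b
  show "zero (submod M N) \<in> carrier (submod M N)" using submoduleD(2)[OF N] by simp
  show "topspace (top (submod M N)) = carrier (submod M N)"
    using submoduleD(1)[OF N] by (simp add: topspace_eq Int_absorb1)
  have "prod_topology (subtopology (top M) N) (subtopology (top M) N)
      = subtopology (prod_topology (top M) (top M)) (N \<times> N)"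
    by (simp add: subtopology_Times)
  then show "continuous_map (prod_topology (top (submod M N)) (top (submod M N))) (top (submod M N))
      (\<lambda>(x, y). add (submod M N) x y)"
    using continuous_map_from_subtopology[OF cont_add, of "N \<times> N"] submoduleD(4)[OF N]
    by (auto simp: continuous_map_in_subtopology)
  show "continuous_map (top (submod M N)) (top (submod M N)) (neg (submod M N))"
    using continuous_map_from_subtopology[OF cont_neg, of N] submoduleD(5)[OF N]
    by (auto simp: continuous_map_in_subtopology)
  have "prod_topology (euclidean :: 'b topology) (subtopology (top M) N)
      = subtopology (prod_topology euclidean (top M)) (UNIV \<times> N)"
    by (simp add: subtopology_Times)
  then show "continuous_map (prod_topology euclidean (top (submod M N))) (top (submod M N))
      (\<lambda>(a, x). act (submod M N) a x)"
    using continuous_map_from_subtopology[OF cont_act, of "UNIV \<times> N"] submoduleD(6)[OF N]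
    by (auto simp: continuous_map_in_subtopology)
  show "Hausdorff_space (top (submod M N))"
    using Hausdorff by (simp add: Hausdorff_space_subtopology)
  assume "x \<in> carrier (submod M N)"
  then have x: "x \<in> N" by simp
  show "neg (submod M N) x \<in> carrier (submod M N)" using submoduleD(5)[OF N x] by simp
  show "act (submod M N) a x \<in> carrier (submod M N)" using submoduleD(6)[OF N x] by simp
  show "add (submod M N) (zero (submod M N)) x = x"
    "add (submod M N) (neg (submod M N) x) x = zero (submod M N)"
    "act (submod M N) 0 x = x"
    using NC[OF x] by simp_all
  show "act (submod M N) (a + b) x = act (submod M N) a (act (submod M N) b x)"
    using act_act[OF NC[OF x]] by simp
  assume "y \<in> carrier (submod M N)"
  then have y: "y \<in> N" by simp
  show "add (submod M N) x y \<in> carrier (submod M N)" using submoduleD(4)[OF N x y] by simp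
  show "add (submod M N) x y = add (submod M N) y x" using add_comm[OF NC[OF x] NC[OF y]] by simp
  show "act (submod M N) a (add (submod M N) x y)
      = add (submod M N) (act (submod M N) a x) (act (submod M N) a y)"
    using act_add[OF NC[OF x] NC[OF y]] by simp
  assume "z \<in> carrier (submod M N)"
  then show "add (submod M N) (add (submod M N) x y) z = add (submod M N) x (add (submod M N) y z)"
    using add_assoc[OF NC[OF x] NC[OF y] NC] by simp
qed

section \<open>The two radicals\<close>

text \<open>A compact parafinite submodule lies in every open submodule, hence in each one that
  occurs in the intersection \<open>Omega_sharp M\<close>.\<close>

lemma W_flat_subset_Omega_sharp: "W_flat M \<subseteq> Omega_sharp M"
proof (rule W_flat_least[OF submodule_Omega_sharp])
  fix N assume N: "submodule M N" "compact_parafinite (submod M N)"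
  show "N \<subseteq> Omega_sharp M"
    unfolding Omega_sharp_def using compact_parafinite_subset_open(2)[OF N] by (intro Inter_greatest) blast
qed

text \<open>If \<open>T\<close> is finite modulo the intersection, it is finite modulo each
  \<open>U\<close>, hence contained in each \<open>U\<close>. Once \<open>Omega_sharp M\<close> is
  open, this applies to its whole defining family.\<close>

lemma purely_discrete_quot_Inter:
  assumes "\<F> \<noteq> {}" and F: "\<And>U. U \<in> \<F> \<Longrightarrow> submodule M U \<and> purely_discrete (quot M U)"
    and op: "openin (top M) (\<Inter>\<F>)"
  shows "purely_discrete (quot M (\<Inter>\<F>))"
proof (rule purely_discrete_quotI)
  show sub: "submodule M (\<Inter>\<F>)" using assms(1) F by (intro submodule_Inter) blast+
  show "openin (top M) (coset M (\<Inter>\<F>) x)" if "x \<in> C" for x using openin_coset[OF op that] .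
  fix T assume T: "submodule M T" "finite (coset M (\<Inter>\<F>) ` T)"
  show "T \<subseteq> \<Inter>\<F>"
  proof (rule Inter_greatest)
    fix U assume U: "U \<in> \<F>"
    then have U': "submodule M U" "purely_discrete (quot M U)" using F by blast+
    have "finite (coset M U ` T)"
      by (rule finite_coset_mono[OF T(2) sub U'(1) submoduleD(1)[OF T(1)]]) (use U in blast)
    then show "T \<subseteq> U" by (rule purely_discrete_quotD[OF U' T(1)])
  qed
qed

text \<open>By \<open>cover\<close>, the second summand of any element can be traded for one in
  \<open>P \<inter> L\<close>. The operations move \<open>P\<close> only into \<open>Q\<close>,
  hence into \<open>V\<close>, and preserve \<open>L\<close>, so their results fall back into the
  sum.\<close>

lemma submodule_setsum_nbhd:
  assumes K: "gen_subgroup K = UNIV"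
    and N: "submodule M N" and L: "submodule M L" "N \<subseteq> L"
    and V: "V \<subseteq> C" "Q \<subseteq> V" "zero M \<in> Q" and P: "P \<subseteq> C"
    and P_add: "\<And>x y. x \<in> P \<Longrightarrow> y \<in> P \<Longrightarrow> x \<oplus> y \<in> Q"
    and P_neg: "\<And>x. x \<in> P \<Longrightarrow> \<ominus> x \<in> Q"
    and P_act: "\<And>a x. a \<in> K \<union> uminus ` K \<Longrightarrow> x \<in> P \<Longrightarrow> act M a x \<in> Q"
    and cover: "V \<inter> L \<subseteq> setsum N P"
  shows "submodule M (setsum N (V \<inter> L))"
proof -
  let ?H = "setsum N (V \<inter> L)"
  have H_I: "n \<oplus> q \<in> ?H" if "n \<in> N" "q \<in> Q" "q \<in> L" for n q
    using that V(2) by (intro setsumI) auto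
  \<comment> \<open>The part \<open>n'\<close> of \<open>v\<close> is absorbed into
    \<open>N\<close>; the remainder \<open>p\<close> is \<open>v\<close> minus \<open>n'\<close> and
    stays in \<open>L\<close> because \<open>N \<subseteq> L\<close>.\<close>
  have H_E: "\<exists>n p. n \<in> N \<and> p \<in> P \<and> p \<in> L \<and> n \<in> C \<and> p \<in> C \<and> h = n \<oplus> p" if "h \<in> ?H" for h
  proof -
    from that obtain n v where h: "h = n \<oplus> v" "n \<in> N" "v \<in> V \<inter> L" by (rule setsumE)
    from subsetD[OF cover h(3)] obtain n' p where v: "v = n' \<oplus> p" "n' \<in> N" "p \<in> P" by (rule setsumE)
    have C': "n \<in> C" "n' \<in> C" "p \<in> C"
      using h(2) v(2,3) submoduleD(3)[OF N] P by blast+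
    have "p = \<ominus> n' \<oplus> v" using v(1) C' by simp
    moreover have "\<ominus> n' \<in> L" using submoduleD(5)[OF N v(2)] L(2) by blast
    ultimately have "p \<in> L" using submoduleD(4)[OF L(1)] h(3) by simp
    moreover have "h = (n \<oplus> n') \<oplus> p" using h(1) v(1) C' by (simp add: add_assoc)
    moreover have "n \<oplus> n' \<in> N" using submoduleD(4)[OF N h(2) v(2)] .
    ultimately show ?thesis using v(3) C' add_in by blast
  qed
  have HC: "?H \<subseteq> C" using submoduleD(1)[OF N] V(1) by (intro setsum_subset) auto
  have act_H: "act M a h \<in> ?H" if a: "a \<in> K \<union> uminus ` K" and h: "h \<in> ?H" for a h
  proof -
    obtain n p where np: "n \<in> N" "p \<in> P" "p \<in> L" "n \<in> C" "p \<in> C" "h = n \<oplus> p" using H_E[OF h] by blast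
    have "act M a n \<oplus> act M a p \<in> ?H"
      by (intro H_I submoduleD(6)[OF N np(1)] P_act[OF a np(2)] submoduleD(6)[OF L(1) np(3)])
    then show ?thesis using np by (simp add: act_add)
  qed
  show ?thesis
    unfolding submodule_def
  proof (intro conjI ballI allI)
    show "?H \<subseteq> C" by fact
    show "zero M \<in> ?H"
      using H_I[OF submoduleD(2)[OF N] V(3) submoduleD(2)[OF L(1)]] by simp
    fix h a assume h: "h \<in> ?H"
    \<comment> \<open>\<open>P_act\<close> speaks only of \<open>a\<close> in \<open>K\<close> or
      its negatives; the generation hypothesis extends this to all of \<open>A\<close>.\<close>
    show "act M a h \<in> ?H" by (rule act_closed_of_generators[OF K HC act_H h])
    obtain n p where np: "n \<in> N" "p \<in> P" "p \<in> L" "n \<in> C" "p \<in> C" "h = n \<oplus> p" using H_E[OF h] by blast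
    have "\<ominus> n \<oplus> \<ominus> p \<in> ?H"
      by (intro H_I submoduleD(5)[OF N np(1)] P_neg[OF np(2)] submoduleD(5)[OF L(1) np(3)])
    then show "\<ominus> h \<in> ?H" using np by (simp add: neg_sum)
    fix h' assume h': "h' \<in> ?H"
    obtain n' p' where np': "n' \<in> N" "p' \<in> P" "p' \<in> L" "n' \<in> C" "p' \<in> C" "h' = n' \<oplus> p'"
      using H_E[OF h'] by blast
    have "(n \<oplus> n') \<oplus> (p \<oplus> p') \<in> ?H"
      by (intro H_I submoduleD(4)[OF N np(1) np'(1)] P_add[OF np(2) np'(2)]
          submoduleD(4)[OF L(1) np(3) np'(3)])
    moreover have "h \<oplus> h' = (n \<oplus> n') \<oplus> (p \<oplus> p')" using np np' by (simp add: add_ac)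
    ultimately show "h \<oplus> h' \<in> ?H" by simp
  qed
qed

section \<open>Openness of the augmented codiscrete radical\<close>

lemma openin_Omega_sharp:
  assumes lc: "locally_compact_space (top M)" and K: "compact K" "gen_subgroup K = (UNIV :: 'b set)"
  shows "openin (top M) (Omega_sharp M)"
proof -
  let ?W = "Omega_sharp M"
  define \<F> where "\<F> = {U. submodule M U \<and> openin (top M) U \<and> purely_discrete (quot M U)}"
  have WF: "?W = \<Inter>\<F>" unfolding \<F>_def Omega_sharp_def ..
  have FD: "submodule M U" "openin (top M) U" "purely_discrete (quot M U)" if "U \<in> \<F>" for U
    using that unfolding \<F>_def by blast+
  note W = submodule_Omega_sharp
  have "zero M \<in> topspace (top M)" by (simp add: topspace_eq)
  then obtain Q V where QV: "openin (top M) Q" "compactin (top M) V" "zero M \<in> Q" "Q \<subseteq> V"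
    using lc unfolding locally_compact_space_def by meson
  have VC: "V \<subseteq> C" using compactin_subset_topspace[OF QV(2)] by (simp add: topspace_eq)
  obtain P where P: "openin (top M) P" "zero M \<in> P"
    "\<And>x y. x \<in> P \<Longrightarrow> y \<in> P \<Longrightarrow> x \<oplus> y \<in> Q" "\<And>x. x \<in> P \<Longrightarrow> \<ominus> x \<in> Q"
    "\<And>a x. a \<in> K \<union> uminus ` K \<Longrightarrow> x \<in> P \<Longrightarrow> act M a x \<in> Q"
    using small_nbhd[OF QV(1,3) compact_symmetrized[OF K(1)]] by metis
  have PC: "P \<subseteq> C" using openin_subset[OF P(1)] by (simp add: topspace_eq)
  have WP: "openin (top M) (setsum ?W P)" by (rule openin_setsum[OF submoduleD(1)[OF W] P(1)])
  have W_WP: "?W \<subseteq> setsum ?W P"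
  proof
    fix x assume x: "x \<in> ?W"
    show "x \<in> setsum ?W P" using setsumI[OF x P(2)] submoduleD(3)[OF W x] by simp
  qed
  have "openin (top M) B" if "B \<in> insert (setsum ?W P) ((\<lambda>U. C - U) ` \<F>)" for B
  proof -
    have "openin (top M) (C - U)" if "U \<in> \<F>" for U
      using closedin_open_submodule[OF FD(1,2)[OF that]] by (simp add: closedin_def topspace_eq)
    then show ?thesis using that WP by blast
  qed
  \<comment> \<open>A point outside \<open>?W\<close> is missed by some \<open>U\<close> in
    \<open>\<F>\<close>, so \<open>?W + P\<close> together with the complements of the members of
    \<open>\<F>\<close> covers \<open>V\<close>.\<close>
  moreover have "V \<subseteq> \<Union>(insert (setsum ?W P) ((\<lambda>U. C - U) ` \<F>))"
  proof
    fix v assume v: "v \<in> V"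
    show "v \<in> \<Union>(insert (setsum ?W P) ((\<lambda>U. C - U) ` \<F>))"
    proof (cases "v \<in> ?W")
      case True then show ?thesis using W_WP by blast
    next
      case False
      then obtain U where "U \<in> \<F>" "v \<notin> U" unfolding WF by blast
      then show ?thesis using v VC by blast
    qed
  qed
  ultimately obtain \<G> where G: "finite \<G>" "\<G> \<subseteq> insert (setsum ?W P) ((\<lambda>U. C - U) ` \<F>)" "V \<subseteq> \<Union>\<G>"
    using compactinD[OF QV(2)] by meson
  \<comment> \<open>Apart from \<open>?W + P\<close>, the finite subcover consists of complements of
    finitely many members of \<open>\<F>\<close>. On their intersection only \<open>?W + P\<close>
    is left to cover \<open>V\<close>.\<close>
  have "finite (\<G> - {setsum ?W P})" "\<G> - {setsum ?W P} \<subseteq> (\<lambda>U. C - U) ` \<F>" using G by blast+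
  then obtain \<F>' where F': "\<F>' \<subseteq> \<F>" "finite \<F>'" "\<G> - {setsum ?W P} = (\<lambda>U. C - U) ` \<F>'"
    by (meson finite_subset_image)
  have CF: "C \<in> \<F>" unfolding \<F>_def by (rule carrier_codiscrete)
  \<comment> \<open>Inserting \<open>C\<close> keeps the intersection inside the module even when
    \<open>\<F>'\<close> is empty.\<close>
  define U0 where "U0 = \<Inter>(insert C \<F>')"
  have sub: "insert C \<F>' \<subseteq> \<F>" using F'(1) CF by simp
  have U0_open: "openin (top M) U0"
    unfolding U0_def using F'(2) FD(2) sub by (intro openin_Inter) auto
  have U0: "submodule M U0"
    unfolding U0_def using FD(1) sub by (intro submodule_Inter) auto
  have W_U0: "?W \<subseteq> U0" unfolding U0_def WF using sub by (rule Inter_anti_mono)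
  have cover: "V \<inter> U0 \<subseteq> setsum ?W P"
  proof
    fix v assume v: "v \<in> V \<inter> U0"
    then obtain B where B: "B \<in> \<G>" "v \<in> B" using G(3) by blast
    show "v \<in> setsum ?W P"
    proof (rule ccontr)
      assume "v \<notin> setsum ?W P"
      then have "B \<in> (\<lambda>U. C - U) ` \<F>'" using B F'(3) by blast
      then show False using B(2) v unfolding U0_def by blast
    qed
  qed
  let ?H = "setsum ?W (V \<inter> U0)"
  have H: "submodule M ?H"
    by (rule submodule_setsum_nbhd[OF K(2) W U0 W_U0 VC QV(4,3) PC P(3,4,5) cover])
  have "?H \<subseteq> ?W"
    unfolding WF
  proof (rule Inter_greatest, fold WF)
    fix U assume "U \<in> \<F>"
    note U = FD[OF this]
    have W_U: "?W \<subseteq> U" unfolding WF using \<open>U \<in> \<F>\<close> by (rule Inter_lower)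
    \<comment> \<open>Modulo \<open>U\<close> the summand from \<open>?W\<close> vanishes, so the
      image of \<open>?H\<close> lies in that of the compact set \<open>V\<close> and is
      finite.\<close>
    have "coset M U ` ?H \<subseteq> coset M U ` V"
    proof clarify
      fix h assume "h \<in> ?H"
      then obtain w v where h: "h = w \<oplus> v" "w \<in> ?W" "v \<in> V \<inter> U0" by (rule setsumE)
      then have C': "w \<in> C" "v \<in> C" using submoduleD(3)[OF W] VC by blast+
      have "w \<in> U" using W_U h(2) by blast
      then have "h \<oplus> \<ominus> v \<in> U" using h(1) C' by (simp add: add_assoc)
      then have "coset M U h = coset M U v" using coset_eq_iff[OF U(1), of h v] h(1) C' by simp
      then show "coset M U h \<in> coset M U ` V" using h(3) by simp
    qed
    then have "finite (coset M U ` ?H)"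
      using finite_coset_compactin[OF U(1,2) QV(2)] by (rule finite_subset)
    then show "?H \<subseteq> U" by (rule purely_discrete_quotD[OF U(1,3) H])
  qed
  \<comment> \<open>With \<open>?H \<subseteq> ?W\<close> this gives \<open>?W\<close> an open
    neighbourhood of zero, which is enough for a submodule to be open.\<close>
  moreover have "Q \<inter> U0 \<subseteq> ?H"
  proof
    fix x assume x: "x \<in> Q \<inter> U0"
    then have "x \<in> V \<inter> U0" "x \<in> C" using QV(4) VC by blast+
    then show "x \<in> ?H" using setsumI[OF submoduleD(2)[OF W], of x "V \<inter> U0"] by simp
  qed
  moreover have "openin (top M) (Q \<inter> U0)" using QV(1) U0_open by (rule openin_Int)
  moreover have "zero M \<in> Q \<inter> U0" using QV(3) submoduleD(2)[OF U0] by simp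
  ultimately show ?thesis by (metis openin_submodule[OF W] subset_trans)
qed

section \<open>Compactness and parafiniteness of the reduced polycompact radical\<close>

lemma closedin_of_compactin_subspace:
  assumes "compactin (top M) N" "closedin (subtopology (top M) N) U"
  shows "closedin (top M) U"
  using closedin_trans_full[OF assms(2) closedin_compactin[OF assms(1)]] .

text \<open>A closed submodule of finite index in the sum has finite index on each summand, so it
  contains both summands and hence their sum.\<close>

lemma compact_parafinite_setsum:
  assumes N: "submodule M N" "compact_parafinite (submod M N)"
    and N': "submodule M N'" "compact_parafinite (submod M N')"
  shows "compact_parafinite (submod M (setsum N N'))"
proof -
  let ?S = "setsum N N'"
  have S: "submodule M ?S" using N(1) N'(1) by (rule submodule_setsum)
  have "compactin (top M) N" "compactin (top M) N'"
    using N N' compact_parafinite_submod by blast+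
  then have cpt: "compactin (top M) ?S" by (rule compactin_setsum)
  moreover have "U = ?S" if U: "submodule M U" "U \<subseteq> ?S" "closedin (subtopology (top M) ?S) U"
      "finite (coset M U ` ?S)" for U
  proof -
    have cl: "closedin (top M) U" using cpt U(3) by (rule closedin_of_compactin_subspace)
    have "L \<subseteq> U" if L: "submodule M L" "compact_parafinite (submod M L)" "L \<subseteq> ?S" for L
    proof (rule compact_parafinite_finite_index[OF L(1,2) U(1)])
      show "closedin (subtopology (top M) L) (U \<inter> L)" using cl unfolding closedin_subtopology by blast
      show "finite (coset M U ` L)" using U(4) image_mono[OF L(3)] by (rule rev_finite_subset)
    qed
    then have "N \<subseteq> U" "N' \<subseteq> U" using N N' setsum_upper[OF N(1) N'(1)] by blast+
    then have "?S \<subseteq> U" using submoduleD(4)[OF U(1)] unfolding setsum_def by blast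
    then show ?thesis using U(2) by blast
  qed
  ultimately show ?thesis unfolding compact_parafinite_submod[OF S] by blast
qed

lemma compact_parafinite_zero: "compact_parafinite (submod M {zero M})"
  unfolding compact_parafinite_submod[OF submodule_zero]
  using submoduleD(2) by (auto simp: topspace_eq)

text \<open>Makes the compact parafinite submodules a directed family: their union is then a
  submodule, and the members picked by a finite subcover fit into a single one. The zero module
  serves the empty family.\<close>

lemma compact_parafinite_finite_upper:
  assumes "finite \<G>" "\<And>N. N \<in> \<G> \<Longrightarrow> submodule M N \<and> compact_parafinite (submod M N)"
  shows "\<exists>N. submodule M N \<and> compact_parafinite (submod M N) \<and> \<Union>\<G> \<subseteq> N"
  using assms
proof (induction \<G> rule: finite_induct)
  case empty
  have "\<Union>{} \<subseteq> {zero M}" by simp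
  then show ?case using submodule_zero compact_parafinite_zero by (intro exI conjI)
next
  case (insert L \<G>)
  have "\<exists>N. submodule M N \<and> compact_parafinite (submod M N) \<and> \<Union>\<G> \<subseteq> N"
    by (rule insert.IH) (rule insert.prems, rule insertI2)
  then obtain N where N: "submodule M N" "compact_parafinite (submod M N)" "\<Union>\<G> \<subseteq> N"
    by (elim exE conjE)
  have L: "submodule M L" "compact_parafinite (submod M L)" using insert.prems[OF insertI1] by simp_all
  have "\<Union>(insert L \<G>) \<subseteq> setsum L N" using setsum_upper[OF L(1) N(1)] N(3) by blast
  then show ?case
    using submodule_setsum[OF L(1) N(1)] compact_parafinite_setsum[OF L N(1,2)] by (intro exI conjI)
qed

lemma compact_parafinite_W_flat:
  assumes lc: "locally_compact_space (top M)" and K: "compact K" "gen_subgroup K = (UNIV :: 'b set)"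
  shows "compact_parafinite (submod M (W_flat M))"
proof -
  define \<F> where "\<F> = {N. submodule M N \<and> compact_parafinite (submod M N)}"
  have FD: "submodule M N" "compact_parafinite (submod M N)" if "N \<in> \<F>" for N
    using that unfolding \<F>_def by blast+
  have dir: "\<exists>N\<in>\<F>. \<Union>\<G> \<subseteq> N" if "finite \<G>" "\<G> \<subseteq> \<F>" for \<G>
  proof -
    have "\<exists>N. submodule M N \<and> compact_parafinite (submod M N) \<and> \<Union>\<G> \<subseteq> N"
      using FD subsetD[OF that(2)] by (intro compact_parafinite_finite_upper[OF that(1)]) simp
    then show ?thesis unfolding \<F>_def by simp
  qed
  define S where "S = \<Union>\<F>"
  have S: "submodule M S"
    unfolding submodule_def
  proof (intro conjI ballI allI)
    show "S \<subseteq> C" unfolding S_def by (intro Union_least submoduleD(1) FD(1))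
    have "{zero M} \<in> \<F>" unfolding \<F>_def using compact_parafinite_zero by simp
    then show "zero M \<in> S" unfolding S_def by blast
    fix x a assume "x \<in> S"
    then obtain N where N: "N \<in> \<F>" "x \<in> N" unfolding S_def by blast
    show "\<ominus> x \<in> S" unfolding S_def using N(1) submoduleD(5)[OF FD(1)[OF N(1)] N(2)] by blast
    show "act M a x \<in> S" unfolding S_def using N(1) submoduleD(6)[OF FD(1)[OF N(1)] N(2)] by blast
    fix y assume "y \<in> S"
    then obtain N' where N': "N' \<in> \<F>" "y \<in> N'" unfolding S_def by blast
    obtain L where L: "L \<in> \<F>" "\<Union>{N, N'} \<subseteq> L" using dir[of "{N, N'}"] N(1) N'(1) by auto
    then have "x \<in> L" "y \<in> L" using N(2) N'(2) by blast+
    then show "x \<oplus> y \<in> S" unfolding S_def using L(1) submoduleD(4)[OF FD(1)[OF L(1)]] by blast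
  qed
  \<comment> \<open>The union \<open>S\<close> is not known to be closed, so its closure is the
    candidate; it is identified with \<open>W_flat M\<close> at the end.\<close>
  define L where "L = top M closure_of S"
  have L: "submodule M L" unfolding L_def using S by (rule submodule_closure)
  have L_least: "L \<subseteq> T" if "S \<subseteq> T" "closedin (top M) T" for T
    unfolding L_def using that by (rule closure_of_minimal)
  have L_closed: "closedin (top M) L" unfolding L_def by simp
  have S_L: "S \<subseteq> L"
    unfolding L_def using submoduleD(1)[OF S] by (intro closure_of_subset) (simp add: topspace_eq)
  have F_L: "N \<subseteq> L" if "N \<in> \<F>" for N using that S_L unfolding S_def by blast
  have "zero M \<in> topspace (top M)" by (simp add: topspace_eq)
  then obtain Q V where QV: "openin (top M) Q" "compactin (top M) V" "zero M \<in> Q" "Q \<subseteq> V"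
    using lc unfolding locally_compact_space_def by meson
  have VC: "V \<subseteq> C" using compactin_subset_topspace[OF QV(2)] by (simp add: topspace_eq)
  obtain P where P: "openin (top M) P" "zero M \<in> P"
    "\<And>x y. x \<in> P \<Longrightarrow> y \<in> P \<Longrightarrow> x \<oplus> y \<in> Q" "\<And>x. x \<in> P \<Longrightarrow> \<ominus> x \<in> Q"
    "\<And>a x. a \<in> K \<union> uminus ` K \<Longrightarrow> x \<in> P \<Longrightarrow> act M a x \<in> Q"
    using small_nbhd[OF QV(1,3) compact_symmetrized[OF K(1)]] by metis
  have PC: "P \<subseteq> C" using openin_subset[OF P(1)] by (simp add: topspace_eq)
  have VL: "compactin (top M) (V \<inter> L)" using QV(2) L_closed by (rule compact_Int_closedin)
  have "V \<inter> L \<subseteq> \<Union>((\<lambda>N. setsum N P) ` \<F>)"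
  proof
    fix x assume "x \<in> V \<inter> L"
    then have xL: "x \<in> L" and x: "x \<in> C" using VC by blast+
    \<comment> \<open>An open neighbourhood of \<open>x\<close>; since \<open>x\<close> is in the
      closure of \<open>S\<close>, it contains a point \<open>y\<close> of \<open>S\<close>, and
      \<open>x\<close> then lies in \<open>y + P\<close>.\<close>
    let ?B = "{y \<in> topspace (top M). x \<oplus> \<ominus> y \<in> P}"
    have "continuous_map (top M) (top M) (\<lambda>y. x \<oplus> \<ominus> y)"
      using continuous_map_compose[OF cont_neg cont_translate[OF x]] by (simp add: o_def)
    then have "openin (top M) ?B" using P(1) by (rule openin_continuous_map_preimage)
    moreover have "x \<in> ?B" using x P(2) by (simp add: topspace_eq)
    ultimately obtain y where y: "y \<in> S" "y \<in> ?B"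
      using xL unfolding L_def in_closure_of by meson
    then obtain N where N: "N \<in> \<F>" "y \<in> N" unfolding S_def by blast
    have "x = y \<oplus> (x \<oplus> \<ominus> y)" using x y(2) by (simp add: topspace_eq)
    then have "x \<in> setsum N P" using setsumI[OF N(2), of "x \<oplus> \<ominus> y" P] y(2) by simp
    then show "x \<in> \<Union>((\<lambda>N. setsum N P) ` \<F>)" using N(1) by blast
  qed
  moreover have "openin (top M) B" if "B \<in> (\<lambda>N. setsum N P) ` \<F>" for B
    using that openin_setsum[OF submoduleD(1)[OF FD(1)] P(1)] by (elim imageE) simp
  ultimately obtain \<G> where G: "finite \<G>" "\<G> \<subseteq> (\<lambda>N. setsum N P) ` \<F>" "V \<inter> L \<subseteq> \<Union>\<G>"
    using compactinD[OF VL] by meson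
  obtain \<F>' where F': "\<F>' \<subseteq> \<F>" "finite \<F>'" "\<G> = (\<lambda>N. setsum N P) ` \<F>'"
    using finite_subset_image[OF G(1,2)] by (elim exE conjE)
  obtain N0 where N0: "N0 \<in> \<F>" "\<Union>\<F>' \<subseteq> N0" using dir[OF F'(2,1)] by (elim bexE)
  have cover: "V \<inter> L \<subseteq> setsum N0 P"
  proof
    fix x assume "x \<in> V \<inter> L"
    then obtain N where "N \<in> \<F>'" "x \<in> setsum N P" using G(3) unfolding F'(3) by blast
    moreover from this have "N \<subseteq> N0" using N0(2) by blast
    ultimately show "x \<in> setsum N0 P" unfolding setsum_def by blast
  qed
  note N0' = FD[OF N0(1)]
  let ?H = "setsum N0 (V \<inter> L)"
  have H: "submodule M ?H"
    by (rule submodule_setsum_nbhd[OF K(2) N0'(1) L F_L[OF N0(1)] VC QV(4,3) PC P(3,4,5) cover])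
  have "compactin (top M) N0" using N0'(2) compact_parafinite_submod[OF N0'(1)] by simp
  then have H_cpt: "compactin (top M) ?H" using VL by (rule compactin_setsum)
  have H_L: "?H \<subseteq> L"
    using F_L[OF N0(1)] submoduleD(4)[OF L] unfolding setsum_def by blast
  \<comment> \<open>The set \<open>?H\<close> need only be open relative to \<open>L\<close>, so the
    results on open submodules are used inside \<open>L\<close> as the ambient module.\<close>
  interpret L: topological_module "submod M L" using L by (rule topological_module_submod)
  have H': "submodule (submod M L) ?H" using H H_L by (simp add: submodule_submod[OF L])
  have "openin (top (submod M L)) ?H"
  proof (rule L.openin_submodule[OF H'])
    show "openin (top (submod M L)) (Q \<inter> L)" using QV(1) by (auto simp: openin_subtopology)
    show "zero (submod M L) \<in> Q \<inter> L" using QV(3) submoduleD(2)[OF L] by simp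
    show "Q \<inter> L \<subseteq> ?H"
    proof
      fix x assume "x \<in> Q \<inter> L"
      then have "x \<in> V \<inter> L" "x \<in> C" using QV(4) VC by blast+
      then show "x \<in> ?H" using setsumI[OF submoduleD(2)[OF N0'(1)], of x "V \<inter> L"] by simp
    qed
  qed
  then have "N \<subseteq> ?H" if "N \<in> \<F>" for N
    using L.compact_parafinite_subset_open(2)[OF _ _ H', of N] FD[OF that] F_L[OF that]
    by (simp add: submod_submod submodule_submod[OF L])
  then have "S \<subseteq> ?H" unfolding S_def by blast
  \<comment> \<open>The sum \<open>?H\<close> is compact, hence closed, and contains
    \<open>S\<close>; so it contains the closure, and the closed set \<open>L\<close> is compact in
    turn.\<close>
  then have "L \<subseteq> ?H" using closedin_compactin[OF H_cpt] by (rule L_least)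
  then have L_cpt: "compactin (top M) L" using H_cpt L_closed closed_compactin by blast
  have "U = L" if U: "submodule M U" "U \<subseteq> L" "closedin (subtopology (top M) L) U"
      "finite (coset M U ` L)" for U
  proof -
    have cl: "closedin (top M) U" using L_cpt U(3) by (rule closedin_of_compactin_subspace)
    \<comment> \<open>A closed submodule of finite index in \<open>L\<close> contains every compact
      parafinite submodule, hence \<open>S\<close> and its closure \<open>L\<close>.\<close>
    have "N \<subseteq> U" if N: "N \<in> \<F>" for N
    proof (rule compact_parafinite_finite_index[OF FD[OF N] U(1)])
      show "closedin (subtopology (top M) N) (U \<inter> N)" using cl unfolding closedin_subtopology by blast
      show "finite (coset M U ` N)" using U(4) image_mono[OF F_L[OF N]] by (rule rev_finite_subset)
    qed
    then have "S \<subseteq> U" unfolding S_def by blast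
    then have "L \<subseteq> U" using cl by (rule L_least)
    then show ?thesis using U(2) by blast
  qed
  then have cpf: "compact_parafinite (submod M L)"
    unfolding compact_parafinite_submod[OF L] using L_cpt by blast
  have "W_flat M = L"
  proof
    show "W_flat M \<subseteq> L" using F_L by (intro W_flat_least[OF L]) (simp add: \<F>_def)
    show "L \<subseteq> W_flat M" using L cpf by (rule W_flat_upper)
  qed
  then show ?thesis using cpf by simp
qed

section \<open>Preimages under a quotient map\<close>

text \<open>The quotient of \<open>M\<close> by \<open>\<Union>S\<close> is the quotient of
  \<open>M/W\<close> by \<open>S\<close>, so a submodule finite over \<open>\<Union>S\<close> has
  finite image in the latter and lies in \<open>S\<close> after passing to cosets.\<close>

lemma purely_discrete_quot_Union:
  assumes W: "submodule M W" and S: "submodule (quot M W) S"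
    and op: "openin (top (quot M W)) S" and pd: "purely_discrete (quot (quot M W) S)"
  shows "openin (top M) (\<Union>S)" "purely_discrete (quot M (\<Union>S))"
proof -
  interpret Q: abgroup_action "quot M W" using W by (rule abgroup_action_quot)
  note US = submodule_quotD[OF W S]
  show op': "openin (top M) (\<Union>S)" using op openin_quot[OF W] by simp
  show "purely_discrete (quot M (\<Union>S))"
  proof (rule purely_discrete_quotI[OF US(1)])
    show "openin (top M) (coset M (\<Union>S) x)" if "x \<in> C" for x using op' that by (rule openin_coset)
    fix T assume T: "submodule M T" "\<Union>S \<subseteq> T" "finite (coset M (\<Union>S) ` T)"
    have WT: "W \<subseteq> T" using US(2) T(2) by (rule subset_trans)
    have "finite (coset (quot M W) S ` coset M W ` T)"
      using T(3) finite_coset_quot_iff[OF W S submoduleD(1)[OF T(1)]] by simp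
    then have "coset M W ` T \<subseteq> S"
      by (rule Q.purely_discrete_quotD[OF S pd submodule_coset_image[OF W T(1) WT]])
    then have "\<Union>(coset M W ` T) \<subseteq> \<Union>S" by (rule Union_mono)
    then show "T \<subseteq> \<Union>S" unfolding Union_coset_image[OF W T(1) WT] .
  qed
qed

text \<open>Purely discrete modules are closed under extensions: a \<open>T\<close> finite modulo
  \<open>U\<close> is finite modulo \<open>L\<close>, hence inside \<open>L\<close>, and there the
  hypothesis on \<open>L/U\<close> places it in \<open>U\<close>.\<close>

lemma purely_discrete_quot_trans:
  assumes L: "submodule M L" "purely_discrete (quot M L)"
    and U: "submodule M U" "openin (top M) U" "U \<subseteq> L" "purely_discrete (quot (submod M L) U)"
  shows "purely_discrete (quot M U)"
proof (rule purely_discrete_quotI[OF U(1) openin_coset[OF U(2)]])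
  fix T assume T: "submodule M T" "finite (coset M U ` T)"
  interpret L: topological_module "submod M L" using L(1) by (rule topological_module_submod)
  have "finite (coset M L ` T)"
    by (rule finite_coset_mono[OF T(2) U(1) L(1) submoduleD(1)[OF T(1)]]) (use U(3) in blast)
  then have "T \<subseteq> L" by (rule purely_discrete_quotD[OF L T(1)])
  then show "T \<subseteq> U"
    using T U(1,3) by (intro L.purely_discrete_quotD[OF _ U(4)]) (simp_all add: submodule_submod[OF L(1)])
qed

text \<open>The quotient map by a compact submodule pulls compact sets back to compact sets, since
  an open cover can be thickened around each compact coset.\<close>

lemma compactin_Union_cosets:
  assumes W: "submodule M W" "compactin (top M) W" and S: "compactin (top (quot M W)) S"
  shows "compactin (top M) (\<Union>S)"
proof -
  interpret Q: abgroup_action "quot M W" using W(1) by (rule abgroup_action_quot)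
  have SC: "S \<subseteq> coset M W ` C"
    using compactin_subset_topspace[OF S] unfolding Q.topspace_eq carrier_quot .
  show ?thesis
    unfolding compactin_def
  proof (intro conjI allI impI)
    show "\<Union>S \<subseteq> topspace (top M)"
      using Union_mono[OF SC] unfolding topspace_eq Union_coset_carrier[OF W(1)] .
    fix \<U> assume \<U>: "(\<forall>B\<in>\<U>. openin (top M) B) \<and> \<Union>S \<subseteq> \<Union>\<U>"
    \<comment> \<open>The saturated core of the union of \<open>\<G>\<close>, the largest union of
      cosets inside it. Being saturated, it descends to an open set of the quotient as soon as it is
      open.\<close>
    define D where "D \<G> = {y \<in> C. coset M W y \<subseteq> \<Union>\<G>}" for \<G>
    have D_open: "openin (top M) (D \<G>)" if "\<G> \<subseteq> \<U>" for \<G>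
    proof (subst openin_subopen, intro ballI)
      fix y assume "y \<in> D \<G>"
      then have y: "y \<in> C" "coset M W y \<subseteq> \<Union>\<G>" unfolding D_def by simp_all
      let ?A = "{p \<in> topspace (prod_topology (top M) (top M)). (\<lambda>(x, y). x \<oplus> y) p \<in> \<Union>\<G>}"
      have "openin (top M) (\<Union>\<G>)"
        using conjunct1[OF \<U>] subsetD[OF that] by (intro openin_Union) simp
      with cont_add have A: "openin (prod_topology (top M) (top M)) ?A"
        by (rule openin_continuous_map_preimage)
      have yc: "compactin (top M) {y}" using y(1) by (simp add: topspace_eq)
      have "{y} \<times> W \<subseteq> ?A"
        using y submoduleD(1)[OF W(1)] by (auto simp: coset_def topspace_eq)
      \<comment> \<open>Wallace's theorem for the compact sets \<open>{y}\<close> and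
        \<open>W\<close> gives a neighbourhood \<open>P\<close> of \<open>y\<close> all of whose
        cosets lie in the union of \<open>\<G>\<close>.\<close>
      then obtain P R where PR: "openin (top M) P" "{y} \<subseteq> P" "W \<subseteq> R" "P \<times> R \<subseteq> ?A"
        by (rule Wallace_theorem_prod_topology[OF yc W(2) A])
      have "P \<subseteq> D \<G>"
      proof
        fix p assume p: "p \<in> P"
        have "p \<in> C" using p openin_subset[OF PR(1)] by (auto simp: topspace_eq)
        moreover have "coset M W p \<subseteq> \<Union>\<G>"
        proof
          fix z assume "z \<in> coset M W p"
          then obtain w where w: "z = p \<oplus> w" "w \<in> W" unfolding coset_def by (rule imageE)
          have "(p, w) \<in> ?A" using p w(2) PR(3,4) by blast
          then show "z \<in> \<Union>\<G>" using w(1) by simp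
        qed
        ultimately show "p \<in> D \<G>" unfolding D_def by simp
      qed
      then show "\<exists>T. openin (top M) T \<and> y \<in> T \<and> T \<subseteq> D \<G>" using PR(1,2) by blast
    qed
    have D_saturated: "\<Union>(coset M W ` D \<G>) = D \<G>" for \<G>
    proof
      show "D \<G> \<subseteq> \<Union>(coset M W ` D \<G>)"
        using self_in_coset[OF W(1)] unfolding D_def by blast
      show "\<Union>(coset M W ` D \<G>) \<subseteq> D \<G>"
      proof clarify
        fix y z assume y: "y \<in> D \<G>" and z: "z \<in> coset M W y"
        have yC: "y \<in> C" using y unfolding D_def by simp
        have "coset M W z = coset M W y" by (rule coset_eq_of_mem[OF W(1) yC z])
        moreover have "z \<in> C" using coset_subset[OF W(1) yC] z by blast
        ultimately show "z \<in> D \<G>" using y unfolding D_def by simp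
      qed
    qed
    \<comment> \<open>Finite subfamilies suffice as indices because each coset is compact; finitely
      many of them again make up a finite subfamily of \<open>\<U>\<close>.\<close>
    let ?\<D> = "(\<lambda>\<G>. coset M W ` D \<G>) ` {\<G>. finite \<G> \<and> \<G> \<subseteq> \<U>}"
    have "openin (top (quot M W)) B" if "B \<in> ?\<D>" for B
    proof -
      obtain \<G> where G: "B = coset M W ` D \<G>" "\<G> \<subseteq> \<U>" using \<open>B \<in> ?\<D>\<close> by auto
      have "coset M W ` D \<G> \<subseteq> coset M W ` C" unfolding D_def by (intro image_mono) simp
      then show ?thesis unfolding openin_quot[OF W(1)] G(1) D_saturated using D_open[OF G(2)] by simp
    qed
    moreover have "S \<subseteq> \<Union>?\<D>"
    proof
      fix c assume c: "c \<in> S"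
      from subsetD[OF SC c] obtain x where x: "c = coset M W x" "x \<in> C" by (rule imageE)
      have "compactin (top M) c"
        unfolding x(1) coset_def using W(2) cont_translate[OF x(2)] by (rule image_compactin)
      moreover have "c \<subseteq> \<Union>\<U>" using Union_upper[OF c] conjunct2[OF \<U>] by (rule subset_trans)
      ultimately obtain \<G> where G: "finite \<G>" "\<G> \<subseteq> \<U>" "c \<subseteq> \<Union>\<G>"
        using compactinD[of "top M" c \<U>] \<U> by meson
      have "x \<in> D \<G>" using G(3) x unfolding D_def by simp
      then have "c \<in> coset M W ` D \<G>" unfolding x(1) by (rule imageI)
      then show "c \<in> \<Union>?\<D>" using G(1,2) by blast
    qed
    ultimately obtain \<E> where E: "finite \<E>" "\<E> \<subseteq> ?\<D>" "S \<subseteq> \<Union>\<E>"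
      using compactinD[OF S] by meson
    obtain \<H> where H: "\<H> \<subseteq> {\<G>. finite \<G> \<and> \<G> \<subseteq> \<U>}" "finite \<H>" "\<E> = (\<lambda>\<G>. coset M W ` D \<G>) ` \<H>"
      using finite_subset_image[OF E(1,2)] by (elim exE conjE)
    have "finite (\<Union>\<H>)" "\<Union>\<H> \<subseteq> \<U>" using H(1,2) by auto
    moreover have "\<Union>S \<subseteq> \<Union>(\<Union>\<H>)"
    proof clarify
      fix z c assume z: "z \<in> c" "c \<in> S"
      then obtain \<G> y where "\<G> \<in> \<H>" "y \<in> D \<G>" "c = coset M W y" using E(3) unfolding H(3) by blast
      then show "z \<in> \<Union>(\<Union>\<H>)" using z(1) unfolding D_def by blast
    qed
    ultimately show "\<exists>\<F>. finite \<F> \<and> \<F> \<subseteq> \<U> \<and> \<Union>S \<subseteq> \<Union>\<F>" by (intro exI conjI)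
  qed
qed

text \<open>Compact parafinite modules are closed under extensions: a closed \<open>U\<close> of
  finite index in the preimage contains \<open>W\<close>, so it comes from a closed submodule of
  finite index in \<open>S\<close>, which is all of \<open>S\<close>.\<close>

lemma compact_parafinite_Union_cosets:
  assumes W: "submodule M W" "compact_parafinite (submod M W)"
    and S: "submodule (quot M W) S" "compact_parafinite (submod (quot M W) S)"
  shows "compact_parafinite (submod M (\<Union>S))"
proof -
  interpret Q: abgroup_action "quot M W" using W(1) by (rule abgroup_action_quot)
  note US = submodule_quotD[OF W(1) S(1)]
  have "compactin (top M) W" using W compact_parafinite_submod by simp
  moreover have "compactin (top (quot M W)) S" using S Q.compact_parafinite_submod by simp
  ultimately have cpt: "compactin (top M) (\<Union>S)" by (rule compactin_Union_cosets[OF W(1)])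
  have "U = \<Union>S" if U: "submodule M U" "U \<subseteq> \<Union>S" "closedin (subtopology (top M) (\<Union>S)) U"
      "finite (coset M U ` \<Union>S)" for U
  proof -
    have cl: "closedin (top M) U" using cpt U(3) by (rule closedin_of_compactin_subspace)
    have WU: "W \<subseteq> U"
    proof (rule compact_parafinite_finite_index[OF W U(1)])
      show "closedin (subtopology (top M) W) (U \<inter> W)" using cl unfolding closedin_subtopology by blast
      show "finite (coset M U ` W)" using U(4) image_mono[OF US(2)] by (rule rev_finite_subset)
    qed
    let ?U = "coset M W ` U"
    have U': "submodule (quot M W) ?U" using W(1) U(1) WU by (rule submodule_coset_image)
    have UU: "\<Union>?U = U" using W(1) U(1) WU by (rule Union_coset_image)
    have US': "?U \<subseteq> S" using image_mono[OF U(2), of "coset M W"] unfolding US(3) .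
    have "closedin (top (quot M W)) ?U"
    proof -
      have sub: "?U \<subseteq> coset M W ` C" using submoduleD(1)[OF U(1)] by (rule image_mono)
      \<comment> \<open>The complement of \<open>?U\<close> in the quotient has preimage
        \<open>C - U\<close>, so closedness of \<open>U\<close> passes to the quotient
        topology.\<close>
      have "\<Union>(coset M W ` C - ?U) = C - U"
      proof
        show "C - U \<subseteq> \<Union>(coset M W ` C - ?U)"
        proof
          fix x assume x: "x \<in> C - U"
          then have "coset M W x \<notin> ?U" using submodule_quotD(4)[OF W(1) U', of x] UU by simp
          then show "x \<in> \<Union>(coset M W ` C - ?U)" using self_in_coset[OF W(1), of x] x by blast
        qed
        show "\<Union>(coset M W ` C - ?U) \<subseteq> C - U"
        proof clarify
          fix x z assume x: "x \<in> C" "coset M W x \<notin> ?U" and z: "z \<in> coset M W x"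
          have zC: "z \<in> C" using coset_subset[OF W(1) x(1)] z by blast
          have "coset M W z = coset M W x" by (rule coset_eq_of_mem[OF W(1) x(1) z])
          then have "z \<notin> U" using x(2) by (metis imageI)
          then show "z \<in> C - U" using zC by simp
        qed
      qed
      moreover have "openin (top M) (C - U)" using cl by (simp add: closedin_def topspace_eq)
      ultimately have "openin (top (quot M W)) (coset M W ` C - ?U)"
        unfolding openin_quot[OF W(1)] by simp
      then show ?thesis using sub by (simp add: closedin_def Q.topspace_eq)
    qed
    then have "closedin (subtopology (top (quot M W)) S) ?U"
      using US' by (intro closedin_subset_topspace)
    moreover have "finite (coset (quot M W) ?U ` S)"
      using finite_coset_quot_iff[OF W(1) U' submoduleD(1)[OF US(1)]] U(4) unfolding UU US(3) by simp
    ultimately have "?U = S"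
      using S(2) U' US' unfolding Q.compact_parafinite_submod[OF S(1)] by simp
    then show ?thesis using UU by simp
  qed
  then show ?thesis unfolding compact_parafinite_submod[OF US(1)] using cpt by simp
qed

text \<open>Closure under extensions handles both radicals. A compact parafinite submodule of the
  subquotient pulls back to one of \<open>M\<close>, which already lies in \<open>W_flat M\<close>;
  an open submodule with purely discrete quotient pulls back to one of \<open>M\<close>, which
  already contains \<open>Omega_sharp M\<close>.\<close>

lemma sheer_subquotient:
  assumes op: "openin (top M) (Omega_sharp M)" and pd: "purely_discrete (quot M (Omega_sharp M))"
    and cpf: "compact_parafinite (submod M (W_flat M))"
  shows "sheer (quot (submod M (Omega_sharp M)) (W_flat M))"
proof -
  let ?L = "Omega_sharp M" and ?W = "W_flat M"
  let ?X = "quot (submod M ?L) ?W"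
  note L = submodule_Omega_sharp and W = submodule_W_flat and W_L = W_flat_subset_Omega_sharp
  interpret L: topological_module "submod M ?L" using L by (rule topological_module_submod)
  have WL: "submodule (submod M ?L) ?W" using W W_L by (simp add: submodule_submod[OF L])
  interpret X: abgroup_action ?X using WL by (rule L.abgroup_action_quot)
  have "W_flat ?X \<subseteq> {zero ?X}"
  proof (rule X.W_flat_least[OF X.submodule_zero])
    fix S assume S: "submodule ?X S" "compact_parafinite (submod ?X S)"
    note US = L.submodule_quotD[OF WL S(1)]
    have U: "submodule M (\<Union>S)" "\<Union>S \<subseteq> ?L" using US(1) by (simp_all add: submodule_submod[OF L])
    have "compact_parafinite (submod (submod M ?L) (\<Union>S))"
      using cpf by (intro L.compact_parafinite_Union_cosets[OF WL _ S]) (simp add: submod_submod[OF W_L])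
    then have "\<Union>S \<subseteq> ?W" using U W_flat_upper by (simp add: submod_submod)
    then have "\<Union>S = ?W" using US(2) by (rule subset_antisym)
    then have "S = coset M ?W ` ?W" using US(3) by simp
    then show "S \<subseteq> {zero ?X}"
      using coset_eq_self_iff[OF W] submoduleD(3)[OF W] by (auto simp: L.zero_quot)
  qed
  moreover have "zero ?X \<in> W_flat ?X" using X.submoduleD(2)[OF X.submodule_W_flat] .
  ultimately have "W_flat ?X = {zero ?X}" by blast
  moreover have "carrier ?X \<subseteq> Omega_sharp ?X"
    unfolding Omega_sharp_def[of ?X]
  proof (rule Inter_greatest)
    fix S assume "S \<in> {U. submodule ?X U \<and> openin (top ?X) U \<and> purely_discrete (quot ?X U)}"
    then have S: "submodule ?X S" "openin (top ?X) S" "purely_discrete (quot ?X S)" by simp_all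
    note US = L.submodule_quotD[OF WL S(1)]
    have U: "submodule M (\<Union>S)" "\<Union>S \<subseteq> ?L" using US(1) by (simp_all add: submodule_submod[OF L])
    note D = L.purely_discrete_quot_Union[OF WL S]
    \<comment> \<open>The preimage is open in \<open>?L\<close>, and \<open>?L\<close> is open in
      \<open>M\<close>.\<close>
    have U_op: "openin (top M) (\<Union>S)"
      using D(1) op openin_trans_full by simp
    have "purely_discrete (quot M (\<Union>S))"
      by (rule purely_discrete_quot_trans[OF L pd U(1) U_op U(2) D(2)])
    then have "?L \<subseteq> \<Union>S" using U(1) U_op unfolding Omega_sharp_def[of M] by (intro Inter_lower) simp
    then have "\<Union>S = ?L" using U(2) by blast
    then have "S = carrier ?X" using US(3) by (simp add: L.carrier_quot)
    then show "carrier ?X \<subseteq> S" by simp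
  qed
  ultimately show ?thesis unfolding sheer_def using X.Omega_sharp_subset by blast
qed

end

lemma topological_module_of_LC_module: "LC_module M \<Longrightarrow> topological_module M"
  unfolding LC_module_def topological_abgroup_def by unfold_locales blast+

theorem mainTheorem2:
  fixes M :: "('a, 'b::{topological_ab_group_add, t2_space}) lcmod"
  assumes "LCA_type TYPE('b)"
    and "LC_module M"
  shows "{zero M} \<subseteq> W_flat M \<and> W_flat M \<subseteq> Omega_sharp M \<and> Omega_sharp M \<subseteq> carrier M \<and>
           (compactly_generated TYPE('b) \<longrightarrow>
           submodule M (W_flat M) \<and> compact_parafinite (submod M (W_flat M)) \<and>
           submodule M (Omega_sharp M) \<and> openin (top M) (Omega_sharp M) \<and>
           purely_discrete (quot M (Omega_sharp M)) \<and>
           sheer (quot (submod M (Omega_sharp M)) (W_flat M)))"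
proof -
  interpret topological_module M using assms(2) by (rule topological_module_of_LC_module)
  have lc: "locally_compact_space (top M)" using assms(2) by (simp add: LC_module_def)
  have "compact_parafinite (submod M (W_flat M)) \<and> openin (top M) (Omega_sharp M) \<and>
      purely_discrete (quot M (Omega_sharp M)) \<and> sheer (quot (submod M (Omega_sharp M)) (W_flat M))"
    if cg: "compactly_generated TYPE('b)"
  proof -
    obtain K :: "'b set" where K: "compact K" "gen_subgroup K = UNIV"
      using cg unfolding compactly_generated_def by metis
    note op = openin_Omega_sharp[OF lc K] and cpf = compact_parafinite_W_flat[OF lc K]
    let ?F = "{U. submodule M U \<and> openin (top M) U \<and> purely_discrete (quot M U)}"
    have "?F \<noteq> {}" using carrier_codiscrete by (metis empty_iff)
    then have "purely_discrete (quot M (Omega_sharp M))"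
      using op unfolding Omega_sharp_def by (intro purely_discrete_quot_Inter) simp_all
    then show ?thesis using op cpf sheer_subquotient by simp
  qed
  moreover have "{zero M} \<subseteq> W_flat M" using submoduleD(2)[OF submodule_W_flat] by simp
  ultimately show ?thesis
    using W_flat_subset_Omega_sharp Omega_sharp_subset submodule_W_flat submodule_Omega_sharp by simp
qed

end
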